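(* Let $N\ge 3$, $k\in(0,N-1)$, $p>0$, and let $\mu\not\equiv 0$ be a positive Radon measure on $\mathbb R^N$ with support contained in the open half space $\mathbb R^N_+$ and whose Newtonian potential $U^\mu$ is finite at every point of $\mathbb R^N$. Consider the problem $$-\Delta u=\mu \text{ in }\mathbb R^N_+,\qquad \frac{\partial u}{\partial n}(x',0)=\lambda\int_{\mathbb R^{N-1}}\frac{u(y',0)^p}{|x'-y'|^k}\,dy' \text{ on }\partial\mathbb R^N_+, \tag{P}$$ with positive solutions understood in the sense defined in the context. Then: (i) If either $0<k\le 1$ and $p>0$, or $1<k<N-1$ and $0<p<\frac{N-1}{k-1}$, then for every $\lambda>0$ problem (P) has no positive solution. (ii) If $1<k<N-1$ and $p=\frac{N-1}{k-1}$, then for every $\lambda>0$ problem (P) has no positive solution $u$ with $u(\cdot,0)\in L^p(\mathbb R^{N-1})$. (iii) If $1<k<N-1$, $p>\frac{N-1}{k-1}$, and there is a constant $C(N,\mu)>0$ with $$U^\mu(x)\le C(N,\mu)(1+|x|)^{1-k}\quad\text{for a.e. }x\in\mathbb R^N,$$ then there exists $\lambda^*>0$ such that for every $0<\lambda<\lambda^*$ problem (P) has a positive solution $u$; moreover $u-\int_{\mathbb R^N_+}G(\cdot,y)\,d\mu(y)\in C^{0,\gamma}(\overline{\mathbb R^N_+})$ for some $\gamma\in(0,1)$.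
   Context: Notation: $\mathbb R^N_+=\mathbb R^{N-1}\times(0,\infty)$, points $x=(x',x_N)$ with $x'\in\mathbb R^{N-1}$; $\partial\mathbb R^N_+=\mathbb R^{N-1}\times\{0\}$; $n=(0,\dots,0,-1)$ so $\frac{\partial u}{\partial n}(x',0)=-\frac{\partial u}{\partial x_N}(x',0)$. $\sigma_N$ is the surface area of the unit sphere in $\mathbb R^N$. The Newtonian potential of a measure $\nu$ is $U^\nu(x)=\frac{1}{(N-2)\sigma_N}\int_{\mathbb R^N}\frac{d\nu(y)}{|x-y|^{N-2}}$. Let $\Phi(x)=\frac{1}{(N-2)\sigma_N}|x|^{2-N}$, $\overline x=(x',-x_N)$, and $G(x,y)=\Phi(x-y)+\Phi(\overline x-y)$ for $x,y\in\overline{\mathbb R^N_+}$ (Neumann Green function of $-\Delta$ in $\mathbb R^N_+$). For a function $u$ define $H_u(x')=\int_{\mathbb R^{N-1}}\frac{u(y',0)^p}{|x'-y'|^k}dy'$. Definition (positive solution of (P)): a measurable $u$ such that (a) $u>0$ a.e. in $\mathbb R^N_+$ and for a.e. $x'\in\mathbb R^{N-1}$ the limit $\lim_{z\in\mathbb R^N_+,\,z\to(x',0)}u(z)$ exists and is finite, and is denoted $u(x',0)$; (b) $H_u$ is finite a.e. in $\mathbb R^{N-1}$ and $\int_{\mathbb R^{N-1}}\frac{H_u(y')}{|x-(y',0)|^{N-2}}dy'<\infty$ for a.e. $x\in\mathbb R^N_+$; (c) for a.e. $x\in\mathbb R^N_+$, $$u(x)=\int_{\mathbb R^N_+}G(x,y)\,d\mu(y)+\frac{2\lambda}{(N-2)\sigma_N}\int_{\mathbb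 R^{N-1}}\int_{\mathbb R^{N-1}}\frac{u(z',0)^p}{|x-(y',0)|^{N-2}|y'-z'|^k}\,dz'\,dy'.$$ *)

theory Defs
  imports "HOL-Analysis.Analysis"
begin

text \<open>Conventions: R^(N-1) is an arbitrary Euclidean space 'a with DIM('a) = N-1,
  and R^N is 'a \<times> real, points x = (x', x_N).\<close>

definition upper_half :: "('a::euclidean_space \<times> real) set" where
  "upper_half = {x. snd x > 0}"

definition closed_upper_half :: "('a::euclidean_space \<times> real) set" where
  "closed_upper_half = {x. snd x \<ge> 0}"

text \<open>Surface area of the unit sphere in R^n: n times the volume of the unit ball.\<close>
definition sigmaN :: "'b::euclidean_space itself \<Rightarrow> real" where
  "sigmaN _ = real DIM('b) * measure lborel (ball (0::'b) 1)"

definition PhiE :: "'b::euclidean_space \<Rightarrow> ennreal" where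
  "PhiE z = (if z = 0 then \<infinity> else
     ennreal (1 / ((real DIM('b) - 2) * sigmaN TYPE('b)) * norm z powr (2 - real DIM('b))))"

definition newton_pot :: "'b::euclidean_space measure \<Rightarrow> 'b \<Rightarrow> ennreal" where
  "newton_pot \<mu> x = (\<integral>\<^sup>+ y. PhiE (x - y) \<partial>\<mu>)"

definition reflect :: "'a \<times> real \<Rightarrow> 'a \<times> real" where
  "reflect x = (fst x, - snd x)"

definition greenN :: "('a::euclidean_space \<times> real) \<Rightarrow> ('a \<times> real) \<Rightarrow> ennreal" where
  "greenN x y = PhiE (x - y) + PhiE (reflect x - y)"

definition radon_measure :: "'b::euclidean_space measure \<Rightarrow> bool" where
  "radon_measure \<mu> \<longleftrightarrow> sets \<mu> = sets borel \<and> (\<forall>K. compact K \<longrightarrow> emeasure \<mu> K < \<infinity>)"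

definition measure_support :: "'b::euclidean_space measure \<Rightarrow> 'b set" where
  "measure_support \<mu> = {x. \<forall>e>0. emeasure \<mu> (ball x e) > 0}"

definition H_u :: "('a::euclidean_space \<times> real \<Rightarrow> real) \<Rightarrow> real \<Rightarrow> real \<Rightarrow> 'a \<Rightarrow> ennreal" where
  "H_u u p k x' = (\<integral>\<^sup>+ y'. ennreal (u (y', 0) powr p / norm (x' - y') powr k) \<partial>lebesgue)"

text \<open>Positive solution of (P). The boundary trace u(x',0) is the value of u at (x',0),
  required to be the limit from inside the half space for a.e. x'.\<close>
definition pos_sol :: "('a::euclidean_space \<times> real) measure \<Rightarrow> real \<Rightarrow> real \<Rightarrow> real
    \<Rightarrow> ('a \<times> real \<Rightarrow> real) \<Rightarrow> bool" where
  "pos_sol \<mu> lam p k u \<longleftrightarrow>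
     u \<in> borel_measurable lebesgue \<and>
     (AE x in lebesgue. x \<in> upper_half \<longrightarrow> u x > 0) \<and>
     (AE x' in lebesgue. (u \<longlongrightarrow> u (x', 0)) (at (x', 0) within upper_half)) \<and>
     (AE x' in lebesgue. H_u u p k x' < \<infinity>) \<and>
     (AE x in lebesgue. x \<in> upper_half \<longrightarrow>
        (\<integral>\<^sup>+ y'. H_u u p k y' * ennreal (1 / norm (x - (y', 0)) powr (real DIM('a \<times> real) - 2))
           \<partial>lebesgue) < \<infinity>) \<and>
     (AE x in lebesgue. x \<in> upper_half \<longrightarrow>
        ennreal (u x) = (\<integral>\<^sup>+ y. greenN x y \<partial>\<mu>) +
          ennreal (2 * lam / ((real DIM('a \<times> real) - 2) * sigmaN TYPE('a \<times> real))) *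
          (\<integral>\<^sup>+ y'. \<integral>\<^sup>+ z'. ennreal (u (z', 0) powr p /
              (norm (x - (y', 0)) powr (real DIM('a \<times> real) - 2) * norm (y' - z') powr k))
            \<partial>lebesgue \<partial>lebesgue))"

definition trace_in_Lp :: "('a::euclidean_space \<times> real \<Rightarrow> real) \<Rightarrow> real \<Rightarrow> bool" where
  "trace_in_Lp u p \<longleftrightarrow> (\<lambda>x'. u (x', 0)) \<in> borel_measurable lebesgue \<and>
     (\<integral>\<^sup>+ x'. ennreal (\<bar>u (x', 0)\<bar> powr p) \<partial>lebesgue) < \<infinity>"

definition hoelder_on :: "real \<Rightarrow> 'b::metric_space set \<Rightarrow> ('b \<Rightarrow> real) \<Rightarrow> bool" where
  "hoelder_on \<gamma> S w \<longleftrightarrow> (\<exists>B. \<forall>x\<in>S. \<bar>w x\<bar> \<le> B) \<and>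
     (\<exists>M. \<forall>x\<in>S. \<forall>y\<in>S. \<bar>w x - w y\<bar> \<le> M * dist x y powr \<gamma>)"

end

(*
Let d = DIM('a) = N - 1 and call a an admissible rate if u(x',0) >= c (1+|x'|)^(-a) for some c > 0.

Nonexistence. The Green potential gives the rate d - 1, and inserting any rate into the representation
formula gives the rate k - 1; if k <= 1 the resulting bound H_u(y) >= c (1+|y|)^(-k) makes the potential
of H_u infinite.  Inserting the rate a gives the rate p a + k - 1 - d, while finiteness of H_u forces
p a > d - k for every admissible rate.  Hence the infimum alpha of the rates is positive and satisfies
alpha + d + 1 - k <= p alpha and alpha <= k - 1, which together yield p (k - 1) >= d.  In the critical
case the rate k - 1 contradicts integrability of u(.,0)^p.

Existence. If p (k - 1) > d, the function A (1+|x'|)^(1-k) is a supersolution of the boundary integral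
equation for small lambda, so monotone iteration from 0 converges.  The boundary density is
O((1+|y|)^(-k)), and |a^(-s) - b^(-s)| <= (1+s) |a-b|^(1/2) (a^(-s-1/2) + b^(-s-1/2)) with s = d - 1
makes its potential Hoelder continuous of exponent 1/2.
*)
theory Submission
  imports Defs
begin

text \<open>Both ways of lowering a rate bound the same convolution from below. A fixed annulus sees
  only the decay of the kernel and yields k - 1 from any rate; an annulus of size comparable to 1 +
  |x| sees the scaling and yields p a + k - 1 - d. Working with the infimum of the rates replaces
  counting iterations and treats p < 1, p = 1 and p > 1 together; alpha > 0, which comes from k < d,
  rules out p <= 1. The identity defining a solution holds only almost everywhere in the half space,
  while the boundary is a null set. The boundary limit of u is what carries lower bounds to the
  trace. The decay hypothesis on U^mu meets the same obstacle in the existence part, where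
  continuity of the potential off the support of mu overcomes it. The supersolution reproduces its
  own decay: its p-th power is integrable because p (k - 1) > d, so its Riesz potential decays like
  the kernel, |y|^(-k), and integration against the kernel of exponent d - 1 over R^d gains exactly
  one power. The Hoelder exponent 1/2 keeps s + 1/2 below d, hence the new kernel locally
  integrable.\<close>

subsection \<open>Power weights and their convolutions\<close>

text \<open>The integrand is dominated by a series of weighted ball indicators whose integrals form
  a geometric series. One statement serves shrinking balls at a singularity and growing balls at
  infinity; full balls instead of shells keep the volumes explicit. Points with
  \<open>f y = 0\<close> are exempt, so an integrand may be cut off by an indicator.\<close>

lemma nn_integral_le_geometric_balls:
  fixes x :: "'a::euclidean_space" and a \<rho> :: "nat \<Rightarrow> real"
  assumes a: "\<And>n. a n \<ge> 0" and \<rho>: "\<And>n. \<rho> n \<ge> 0" and K: "\<And>n. a n * \<rho> n ^ DIM('a) = K * q ^ n"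
    and q: "0 \<le> q" "q < 1"
    and f: "\<And>y. f y \<noteq> 0 \<Longrightarrow> \<exists>n. f y \<le> ennreal (a n) \<and> y \<in> cball x (\<rho> n)"
  shows "(\<integral>\<^sup>+y. f y \<partial>lborel) \<le> ennreal (unit_ball_vol DIM('a) * K / (1 - q))"
proof -
  have "(\<integral>\<^sup>+y. f y \<partial>lborel) \<le> (\<integral>\<^sup>+y. (\<Sum>n. ennreal (a n) * indicator (cball x (\<rho> n)) y) \<partial>lborel)"
  proof (rule nn_integral_mono)
    fix y
    show "f y \<le> (\<Sum>n. ennreal (a n) * indicator (cball x (\<rho> n)) y)"
    proof (cases "f y = 0")
      case False
      then obtain n where n: "f y \<le> ennreal (a n)" "y \<in> cball x (\<rho> n)" using f by blast
      have "(\<Sum>i\<in>{n}. ennreal (a i) * indicator (cball x (\<rho> i)) y)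
          \<le> (\<Sum>n. ennreal (a n) * indicator (cball x (\<rho> n)) y)"
        by (rule sum_le_suminf) auto
      with n show ?thesis by auto
    qed simp
  qed
  also have "\<dots> = (\<Sum>n. \<integral>\<^sup>+y. ennreal (a n) * indicator (cball x (\<rho> n)) y \<partial>lborel)"
    by (rule nn_integral_suminf) (auto intro!: borel_measurable_times_ennreal borel_measurable_indicator)
  also have "\<dots> = (\<Sum>n. ennreal (unit_ball_vol DIM('a) * K * q ^ n))"
  proof (rule arg_cong[where f=suminf], rule ext)
    fix n
    have "(\<integral>\<^sup>+y. ennreal (a n) * indicator (cball x (\<rho> n)) y \<partial>lborel)
        = ennreal (a n * (unit_ball_vol DIM('a) * \<rho> n ^ DIM('a)))"
      using a \<rho> by (simp add: nn_integral_cmult_indicator emeasure_cball ennreal_mult)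
    also have "a n * (unit_ball_vol DIM('a) * \<rho> n ^ DIM('a)) = unit_ball_vol DIM('a) * K * q ^ n"
      using K[of n] by (simp add: algebra_simps)
    finally show "(\<integral>\<^sup>+y. ennreal (a n) * indicator (cball x (\<rho> n)) y \<partial>lborel)
      = ennreal (unit_ball_vol DIM('a) * K * q ^ n)" .
  qed
  also have "\<dots> = ennreal (unit_ball_vol DIM('a) * K / (1 - q))"
  proof (rule suminf_ennreal_eq)
    have "K * q ^ 0 \<ge> 0" unfolding K[symmetric] using a \<rho> by simp
    then show "0 \<le> unit_ball_vol DIM('a) * K * q ^ n" for n using q by simp
    show "(\<lambda>n. unit_ball_vol DIM('a) * K * q ^ n) sums (unit_ball_vol DIM('a) * K / (1 - q))"
      using sums_mult[OF geometric_sums[of q], of "unit_ball_vol DIM('a) * K"] q by simp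
  qed
  finally show ?thesis .
qed

text \<open>On the shell R/2^(n+1) < |x-y| <= R/2^n the integrand is at most (R/2^(n+1))^(-s), and
  the enclosing ball has volume of order (R/2^n)^d. The ratio of consecutive terms is 2^(s-d), below
  1 because s < d.\<close>

lemma nn_integral_powr_cball:
  assumes "0 < s" "s < real DIM('a::euclidean_space)"
  shows "\<exists>C>0. \<forall>(x::'a) R. R > 0 \<longrightarrow>
    (\<integral>\<^sup>+y. ennreal (norm (x - y) powr - s) * indicator (cball x R) y \<partial>lborel)
      \<le> ennreal (C * R powr (real DIM('a) - s))"
proof -
  define d where "d = real DIM('a)"
  define q :: real where "q = 2 powr (s - d)"
  have q: "0 \<le> q" "q < 1" unfolding q_def using assms by (auto simp: d_def powr_less_one)
  let ?V = "unit_ball_vol d"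
  let ?C = "?V * 2 powr s / (1 - q)"
  have "(\<integral>\<^sup>+y. ennreal (norm (x - y) powr - s) * indicator (cball x R) y \<partial>lborel)
      \<le> ennreal (?C * R powr (d - s))" if R: "R > 0" for x :: 'a and R
  proof -
    have "(\<integral>\<^sup>+y. ennreal (norm (x - y) powr - s) * indicator (cball x R) y \<partial>lborel)
       \<le> ennreal (unit_ball_vol DIM('a) * (2 powr s * R powr (d - s)) / (1 - q))"
    proof (rule nn_integral_le_geometric_balls[where a="\<lambda>n. (R / 2 ^ Suc n) powr - s" and \<rho>="\<lambda>n. R / 2 ^ n"])
      fix n
      have "(R / 2 ^ Suc n) powr - s * (R / 2 ^ n) ^ DIM('a)
        = (R / 2 ^ Suc n) powr - s * (R / 2 ^ n) powr d"
        using R by (simp add: d_def powr_realpow)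
      also have "\<dots> = 2 powr s * R powr (d - s) * q ^ n"
        unfolding q_def using R
        by (simp add: powr_def ln_div ln_mult ln_realpow exp_add[symmetric] exp_diff[symmetric]
            exp_of_nat_mult[symmetric] algebra_simps)
      finally show "(R / 2 ^ Suc n) powr - s * (R / 2 ^ n) ^ DIM('a) = 2 powr s * R powr (d - s) * q ^ n" .
    next
      fix y :: 'a
      assume "ennreal (norm (x - y) powr - s) * indicator (cball x R) y \<noteq> 0"
      \<comment> \<open>The centre lies in no shell, but the integrand vanishes there because
        \<open>0 powr - s = 0\<close>.\<close>
      then have y: "x \<noteq> y" "norm (x - y) \<le> R" by (auto simp: indicator_def dist_norm split: if_splits)
      have ex: "\<exists>n. R / 2 ^ Suc n < norm (x - y)"
      proof -
        obtain n where "R / norm (x - y) < 2 ^ n" using real_arch_pow[of 2] by auto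
        also have "(2::real) ^ n \<le> 2 ^ Suc n" by simp
        finally have "R / norm (x - y) < 2 ^ Suc n" .
        then show ?thesis using y by (auto simp: field_simps)
      qed
      \<comment> \<open>Minimality supplies the outer bound: the preceding index fails, and for n =
        0 the bound is the radius itself.\<close>
      define n where "n = (LEAST n. R / 2 ^ Suc n < norm (x - y))"
      have n1: "R / 2 ^ Suc n < norm (x - y)" unfolding n_def by (rule LeastI_ex[OF ex])
      have n2: "norm (x - y) \<le> R / 2 ^ n"
      proof (cases n)
        case (Suc m)
        then have "\<not> (R / 2 ^ Suc m < norm (x - y))" by (metis lessI n_def not_less_Least)
        then show ?thesis using Suc by simp
      qed (use y in simp)
      have "norm (x - y) powr - s \<le> (R / 2 ^ Suc n) powr - s"
        by (rule powr_mono2') (use n1 R assms in auto)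
      with n2 y show "\<exists>n. ennreal (norm (x - y) powr - s) * indicator (cball x R) y
           \<le> ennreal ((R / 2 ^ Suc n) powr - s) \<and> y \<in> cball x (R / 2 ^ n)"
        by (intro exI[of _ n]) (auto simp: indicator_def dist_norm intro!: ennreal_leI)
    qed (use R q in auto)
    then show ?thesis by (simp add: d_def mult_ac)
  qed
  moreover have "?C > 0" using q by (simp add: d_def)
  ultimately show ?thesis unfolding d_def by blast
qed

text \<open>The shells now grow, R 2^n <= |x-y| <= R 2^(n+1), and the ratio 2^(d-m) is below 1
  because m > d.\<close>

lemma nn_integral_powr_outside_ball:
  assumes "real DIM('a::euclidean_space) < m"
  shows "\<exists>C>0. \<forall>(x::'a) R. R > 0 \<longrightarrow>
    (\<integral>\<^sup>+y. ennreal (norm (x - y) powr - m) * indicator (- ball x R) y \<partial>lborel)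
      \<le> ennreal (C * R powr (real DIM('a) - m))"
proof -
  define d where "d = real DIM('a)"
  have m: "m > 0" using assms by (smt (verit) of_nat_0_le_iff)
  define q :: real where "q = 2 powr (d - m)"
  have q: "0 \<le> q" "q < 1" unfolding q_def using assms by (auto simp: d_def powr_less_one)
  let ?V = "unit_ball_vol d"
  let ?C = "?V * 2 powr d / (1 - q)"
  have "(\<integral>\<^sup>+y. ennreal (norm (x - y) powr - m) * indicator (- ball x R) y \<partial>lborel)
      \<le> ennreal (?C * R powr (d - m))" if R: "R > 0" for x :: 'a and R
  proof -
    have "(\<integral>\<^sup>+y. ennreal (norm (x - y) powr - m) * indicator (- ball x R) y \<partial>lborel)
       \<le> ennreal (unit_ball_vol DIM('a) * (2 powr d * R powr (d - m)) / (1 - q))"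
    proof (rule nn_integral_le_geometric_balls[where a="\<lambda>n. (R * 2 ^ n) powr - m" and \<rho>="\<lambda>n. R * 2 ^ Suc n"])
      fix n
      have "(R * 2 ^ n) powr - m * (R * 2 ^ Suc n) ^ DIM('a)
        = (R * 2 ^ n) powr - m * (R * 2 ^ Suc n) powr d"
        using R by (simp add: d_def powr_realpow)
      also have "\<dots> = 2 powr d * R powr (d - m) * q ^ n"
        unfolding q_def using R
        by (simp add: powr_def ln_div ln_mult ln_realpow exp_add[symmetric] exp_diff[symmetric]
            exp_of_nat_mult[symmetric] algebra_simps)
      finally show "(R * 2 ^ n) powr - m * (R * 2 ^ Suc n) ^ DIM('a) = 2 powr d * R powr (d - m) * q ^ n" .
    next
      fix y :: 'a
      assume "ennreal (norm (x - y) powr - m) * indicator (- ball x R) y \<noteq> 0"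
      then have y: "R \<le> norm (x - y)" by (auto simp: indicator_def dist_norm split: if_splits)
      have ex: "\<exists>n. norm (x - y) \<le> R * 2 ^ Suc n"
      proof -
        obtain n where "norm (x - y) / R < 2 ^ n" using real_arch_pow[of 2] by auto
        also have "(2::real) ^ n \<le> 2 ^ Suc n" by simp
        finally have "norm (x - y) / R < 2 ^ Suc n" .
        then show ?thesis using R by (auto simp: field_simps intro: less_imp_le)
      qed
      define n where "n = (LEAST n. norm (x - y) \<le> R * 2 ^ Suc n)"
      have n1: "norm (x - y) \<le> R * 2 ^ Suc n" unfolding n_def by (rule LeastI_ex[OF ex])
      have n2: "R * 2 ^ n \<le> norm (x - y)"
      proof (cases n)
        case (Suc k)
        then have "\<not> (norm (x - y) \<le> R * 2 ^ Suc k)" by (metis lessI n_def not_less_Least)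
        then show ?thesis using Suc by simp
      qed (use y in simp)
      have "norm (x - y) powr - m \<le> (R * 2 ^ n) powr - m"
        by (rule powr_mono2') (use n2 R m in auto)
      with n1 y show "\<exists>n. ennreal (norm (x - y) powr - m) * indicator (- ball x R) y
           \<le> ennreal ((R * 2 ^ n) powr - m) \<and> y \<in> cball x (R * 2 ^ Suc n)"
        by (intro exI[of _ n]) (auto simp: indicator_def dist_norm intro!: ennreal_leI)
    qed (use R q in auto)
    then show ?thesis by (simp add: d_def mult_ac)
  qed
  moreover have "?C > 0" using q by (simp add: d_def)
  ultimately show ?thesis unfolding d_def by blast
qed

text \<open>The annulus contains a ball of radius r about any point of norm 3r, so its mass is
  bounded below without polar coordinates. The bound on \<open>f\<close> is asked only almost
  everywhere so that a singular point can be discarded.\<close>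

lemma nn_integral_annulus_ge:
  fixes f :: "'a::euclidean_space \<Rightarrow> ennreal"
  assumes f: "AE y in lborel. 2 * r \<le> norm y \<longrightarrow> norm y \<le> 4 * r \<longrightarrow> ennreal c \<le> f y"
    and r: "r > 0" and c: "c \<ge> 0"
  shows "ennreal (c * unit_ball_vol DIM('a) * r powr DIM('a)) \<le> (\<integral>\<^sup>+y. f y \<partial>lborel)"
proof -
  obtain e :: 'a where e: "norm e = 1" using vector_choose_size[of 1] by auto
  define z where "z = (3 * r) *\<^sub>R e"
  have z: "norm z = 3 * r" using r e by (simp add: z_def)
  have "ennreal (c * unit_ball_vol DIM('a) * r powr DIM('a))
      = (\<integral>\<^sup>+y. ennreal c * indicator (ball z r) y \<partial>lborel)"
    using r c by (simp add: nn_integral_cmult_indicator emeasure_ball ennreal_mult[symmetric] powr_realpow mult_ac)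
  also have "\<dots> \<le> (\<integral>\<^sup>+y. f y \<partial>lborel)"
  proof (rule nn_integral_mono_AE, rule AE_mp[OF f], rule AE_I2, rule impI)
    fix y
    assume f: "2 * r \<le> norm y \<longrightarrow> norm y \<le> 4 * r \<longrightarrow> ennreal c \<le> f y"
    show "ennreal c * indicator (ball z r) y \<le> f y"
    proof (cases "y \<in> ball z r")
      case True
      then have "norm (z - y) < r" by (simp add: dist_norm)
      then have "2 * r \<le> norm y" "norm y \<le> 4 * r"
        using norm_triangle_ineq2[of z y] norm_triangle_ineq2[of y z] z by (auto simp: norm_minus_commute)
      then show ?thesis using f True by simp
    qed simp
  qed
  finally show ?thesis .
qed

lemma nn_integral_powr_DIM_infinite:
  fixes f :: "'a::euclidean_space \<Rightarrow> ennreal"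
  assumes c: "c > 0" and f: "\<And>y. R \<le> norm y \<Longrightarrow> ennreal (c * norm y powr - real DIM('a)) \<le> f y"
  shows "(\<integral>\<^sup>+y. f y \<partial>lborel) = \<infinity>"
proof (rule ccontr)
  assume "(\<integral>\<^sup>+y. f y \<partial>lborel) \<noteq> \<infinity>"
  then have fin: "(\<integral>\<^sup>+y. f y \<partial>lborel) < \<infinity>" by (simp add: top.not_eq_extremum)
  \<comment> \<open>Dominated convergence needs measurability, which \<open>f\<close> may lack; the
    tail argument therefore runs on this measurable minorant.\<close>
  define g :: "'a \<Rightarrow> ennreal" where "g y = ennreal (c * norm y powr - real DIM('a)) * indicator {y. R \<le> norm y} y" for y
  have [measurable]: "g \<in> borel_measurable lborel" unfolding g_def by measurable
  have "(\<integral>\<^sup>+y. g y \<partial>lborel) \<le> (\<integral>\<^sup>+y. f y \<partial>lborel)"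
    by (rule nn_integral_mono) (auto simp: g_def indicator_def f)
  then have g: "(\<integral>\<^sup>+y. g y \<partial>lborel) < \<infinity>" using fin by (rule le_less_trans)
  \<comment> \<open>The tails of a finite integral vanish, but every dyadic annulus carries mass at least \<open>b\<close>.\<close>
  define u :: "nat \<Rightarrow> 'a \<Rightarrow> ennreal" where "u n y = g y * indicator {y. real n \<le> norm y} y" for n y
  have "(\<lambda>n. \<integral>\<^sup>+y. u n y \<partial>lborel) \<longlonglongrightarrow> (\<integral>\<^sup>+y. 0 \<partial>(lborel::'a measure))"
  proof (rule nn_integral_dominated_convergence[where w=g])
    show "AE y in lborel. (\<lambda>n. u n y) \<longlonglongrightarrow> 0"
    proof (rule AE_I2)
      fix y :: 'a
      obtain N :: nat where "norm y < N" using reals_Archimedean2 by blast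
      then have "\<forall>n\<ge>N. u n y = 0" by (auto simp: u_def)
      then show "(\<lambda>n. u n y) \<longlonglongrightarrow> 0"
        by (intro tendsto_eventually) (auto simp: eventually_sequentially)
    qed
  qed (use g in \<open>auto simp: u_def indicator_def\<close>)
  then have lim: "(\<lambda>n. \<integral>\<^sup>+y. u n y \<partial>lborel) \<longlonglongrightarrow> 0" by simp
  \<comment> \<open>For |y| <= 4n the minorant is at least c (4n)^(-d), and the ball inside the
    annulus has volume V n^d with V the unit ball volume; the powers of n cancel.\<close>
  define b where "b = c * 4 powr - real DIM('a) * unit_ball_vol DIM('a)"
  have b: "b > 0" using c by (simp add: b_def)
  have "\<forall>\<^sub>F n in sequentially. ennreal b \<le> (\<integral>\<^sup>+y. u n y \<partial>lborel)"
  proof -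
    obtain N :: nat where N: "R < N" "0 < N" using reals_Archimedean2[of "max R 0"] by auto
    have "ennreal b \<le> (\<integral>\<^sup>+y. u n y \<partial>lborel)" if "n \<ge> N" for n
    proof -
      have n: "real n > 0" "R \<le> real n" using N that by auto
      have "ennreal ((c * (4 * real n) powr - real DIM('a)) * unit_ball_vol DIM('a) * real n powr DIM('a))
         \<le> (\<integral>\<^sup>+y. u n y \<partial>lborel)"
      proof (rule nn_integral_annulus_ge, intro AE_I2 impI)
        fix y :: 'a assume y: "2 * real n \<le> norm y" "norm y \<le> 4 * real n"
        have "(4 * real n) powr - real DIM('a) \<le> norm y powr - real DIM('a)"
          by (rule powr_mono2') (use y n in auto)
        then show "ennreal (c * (4 * real n) powr - real DIM('a)) \<le> u n y"
          using y n c by (auto simp: u_def g_def intro!: ennreal_leI mult_left_mono)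
      qed (use n c in auto)
      also have "(c * (4 * real n) powr - real DIM('a)) * unit_ball_vol DIM('a) * real n powr DIM('a) = b"
        using n by (simp add: b_def powr_mult powr_minus field_simps)
      finally show ?thesis .
    qed
    then show ?thesis by (auto simp: eventually_sequentially)
  qed
  from tendsto_lowerbound[OF lim this] b show False by simp
qed

text \<open>This integrates a pointwise majorant split over near, intermediate and far regions; a
  split into two regions passes zero as the third term.\<close>

lemma nn_integral_le_add3:
  assumes "g1 \<in> borel_measurable M" "g2 \<in> borel_measurable M" "g3 \<in> borel_measurable M"
    and "0 \<le> a1" "0 \<le> a2" "0 \<le> a3" "0 \<le> A1" "0 \<le> A2" "0 \<le> A3"
    and f: "AE y in M. f y \<le> ennreal a1 * g1 y + (ennreal a2 * g2 y + ennreal a3 * g3 y)"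
    and g: "(\<integral>\<^sup>+y. g1 y \<partial>M) \<le> ennreal A1" "(\<integral>\<^sup>+y. g2 y \<partial>M) \<le> ennreal A2" "(\<integral>\<^sup>+y. g3 y \<partial>M) \<le> ennreal A3"
  shows "(\<integral>\<^sup>+y. f y \<partial>M) \<le> ennreal (a1 * A1 + (a2 * A2 + a3 * A3))"
proof -
  have "(\<integral>\<^sup>+y. f y \<partial>M) \<le> (\<integral>\<^sup>+y. ennreal a1 * g1 y + (ennreal a2 * g2 y + ennreal a3 * g3 y) \<partial>M)"
    by (rule nn_integral_mono_AE[OF f])
  also have "\<dots> = ennreal a1 * (\<integral>\<^sup>+y. g1 y \<partial>M) + (ennreal a2 * (\<integral>\<^sup>+y. g2 y \<partial>M) + ennreal a3 * (\<integral>\<^sup>+y. g3 y \<partial>M))"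
    using assms(1-3) by (simp add: nn_integral_add nn_integral_cmult)
  also have "\<dots> \<le> ennreal a1 * ennreal A1 + (ennreal a2 * ennreal A2 + ennreal a3 * ennreal A3)"
    using g by (intro add_mono mult_left_mono) auto
  also have "\<dots> = ennreal (a1 * A1 + (a2 * A2 + a3 * A3))"
    using assms(4-9) by (simp add: ennreal_mult ennreal_plus)
  finally show ?thesis .
qed

section \<open>Upper and lower bounds for convolutions of (1 + |y|)^(-m) with power kernels\<close>

lemma nn_integral_weight_finite:
  assumes "real DIM('a::euclidean_space) < m"
  shows "\<exists>C>0. (\<integral>\<^sup>+y. ennreal ((1 + norm (y::'a)) powr - m) \<partial>lborel) \<le> ennreal C"
proof -
  have m: "m > 0" using assms by (smt (verit) of_nat_0_le_iff)
  obtain C where C: "C > 0" "\<And>(x::'a) R. R > 0 \<Longrightarrow>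
    (\<integral>\<^sup>+y. ennreal (norm (x - y) powr - m) * indicator (- ball x R) y \<partial>lborel)
      \<le> ennreal (C * R powr (real DIM('a) - m))"
    using nn_integral_powr_outside_ball[OF assms] by blast
  have "(\<integral>\<^sup>+y. ennreal ((1 + norm (y::'a)) powr - m) \<partial>lborel)
    \<le> ennreal (1 * unit_ball_vol DIM('a) + (1 * C + 0 * 0))"
  proof (rule nn_integral_le_add3[where ?g1.0="indicator (cball 0 1)" and ?g3.0="\<lambda>_. 0" and
        ?g2.0="\<lambda>y. ennreal (norm (0 - y) powr - m) * indicator (- ball 0 1) y"])
    show "AE y in lborel. ennreal ((1 + norm (y::'a)) powr - m)
       \<le> ennreal 1 * indicator (cball 0 1) y +
        (ennreal 1 * (ennreal (norm (0 - y) powr - m) * indicator (- ball 0 1) y) + ennreal 0 * 0)"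
    proof (rule AE_I2)
      fix y :: 'a
      show "ennreal ((1 + norm (y::'a)) powr - m)
       \<le> ennreal 1 * indicator (cball 0 1) y +
        (ennreal 1 * (ennreal (norm (0 - y) powr - m) * indicator (- ball 0 1) y) + ennreal 0 * 0)"
      proof (cases "norm y \<le> 1")
        case True
        have "(1 + norm y) powr - m \<le> 1 powr - m" by (rule powr_mono2') (use m in auto)
        then have "ennreal ((1 + norm y) powr - m) \<le> 1" by simp
        then show ?thesis using True by (auto intro: add_increasing2)
      next
        case False
        have "(1 + norm y) powr - m \<le> norm y powr - m" by (rule powr_mono2') (use m False in auto)
        then show ?thesis using False by (auto intro: ennreal_leI)
      qed
    qed
    show "integral\<^sup>N lborel (indicator (cball (0::'a) 1)) \<le> ennreal (unit_ball_vol (real DIM('a)))"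
      by (simp add: emeasure_cball)
    show "(\<integral>\<^sup>+y. ennreal (norm (0 - y) powr - m) * indicator (- ball (0::'a) 1) y \<partial>lborel) \<le> ennreal C"
      using C(2)[of 1 0] by simp
  qed (use C in \<open>auto intro!: borel_measurable_times_ennreal borel_measurable_indicator\<close>)
  then show ?thesis using C(1) by (intro exI[of _ "unit_ball_vol DIM('a) + C"]) (auto intro: add_nonneg_pos)
qed

text \<open>Put R = 1 + |x| and split at |x-y| = R/2. Near x the weight is of order at most R^(-m)
  and the kernel integrates to R^(d-s); since m > d, the product is below R^(-s). Far from x the
  kernel is of order at most R^(-s) and the weight is integrable.\<close>

lemma convolution_integrable_weight_bound:
  assumes s: "0 < s" "s < real DIM('a::euclidean_space)" and m: "real DIM('a) < m"
  shows "\<exists>C>0. \<forall>x::'a. (\<integral>\<^sup>+y. ennreal ((1 + norm y) powr - m * norm (x - y) powr - s) \<partial>lborel)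
    \<le> ennreal (C * (1 + norm x) powr - s)"
proof -
  let ?d = "real DIM('a)"
  obtain C1 where C1: "C1 > 0" "\<And>(x::'a) R. R > 0 \<Longrightarrow>
    (\<integral>\<^sup>+y. ennreal (norm (x - y) powr - s) * indicator (cball x R) y \<partial>lborel)
      \<le> ennreal (C1 * R powr (?d - s))"
    using nn_integral_powr_cball[OF s] by blast
  obtain C2 where C2: "C2 > 0" "(\<integral>\<^sup>+y. ennreal ((1 + norm (y::'a)) powr - m) \<partial>lborel) \<le> ennreal C2"
    using nn_integral_weight_finite[OF m] by blast
  let ?C = "2 powr m * 2 powr (s - ?d) * C1 + 2 powr s * C2"
  have "(\<integral>\<^sup>+y. ennreal ((1 + norm y) powr - m * norm (x - y) powr - s) \<partial>lborel)
    \<le> ennreal (?C * (1 + norm x) powr - s)" for x :: 'a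
  proof -
    define R where "R = 1 + norm x"
    have R: "R \<ge> 1" by (simp add: R_def)
    have half: "(R / 2) powr - e = 2 powr e * R powr - e" for e
      using R by (simp add: powr_divide powr_minus field_simps)
    have "(\<integral>\<^sup>+y. ennreal ((1 + norm y) powr - m * norm (x - y) powr - s) \<partial>lborel)
      \<le> ennreal ((2 powr m * R powr - m) * (C1 * (R/2) powr (?d - s)) + ((2 powr s * R powr - s) * C2 + 0 * 0))"
    proof (rule nn_integral_le_add3[where ?g1.0="\<lambda>y. ennreal (norm (x - y) powr - s) * indicator (cball x (R/2)) y"
            and ?g2.0="\<lambda>y. ennreal ((1 + norm y) powr - m)" and ?g3.0="\<lambda>_. 0"])
      show "AE y in lborel. ennreal ((1 + norm y) powr - m * norm (x - y) powr - s) \<le>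
         ennreal (2 powr m * R powr - m) * (ennreal (norm (x - y) powr - s) * indicator (cball x (R/2)) y)
         + (ennreal (2 powr s * R powr - s) * ennreal ((1 + norm y) powr - m) + ennreal 0 * 0)"
      proof (rule AE_I2)
        fix y :: 'a
        show "ennreal ((1 + norm y) powr - m * norm (x - y) powr - s) \<le>
         ennreal (2 powr m * R powr - m) * (ennreal (norm (x - y) powr - s) * indicator (cball x (R/2)) y)
         + (ennreal (2 powr s * R powr - s) * ennreal ((1 + norm y) powr - m) + ennreal 0 * 0)"
        proof (cases "norm (x - y) \<le> R / 2")
          case True
          have "R / 2 \<le> 1 + norm y" using True norm_triangle_ineq2[of x y] by (simp add: R_def)
          then have "(1 + norm y) powr - m \<le> (R / 2) powr - m"
            by (intro powr_mono2') (use R m in auto)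
          then have "(1 + norm y) powr - m * norm (x - y) powr - s \<le> (2 powr m * R powr - m) * norm (x - y) powr - s"
            unfolding half by (rule mult_right_mono) auto
          then show ?thesis using True
            by (auto simp: ennreal_mult[symmetric] dist_norm intro!: add_increasing2 ennreal_leI)
        next
          case False
          then have "norm (x - y) powr - s \<le> (R / 2) powr - s"
            by (intro powr_mono2') (use R s in auto)
          then have "(1 + norm y) powr - m * norm (x - y) powr - s \<le> (1 + norm y) powr - m * (2 powr s * R powr - s)"
            unfolding half by (rule mult_left_mono) auto
          then show ?thesis using False
            by (auto simp: ennreal_mult[symmetric] dist_norm mult_ac intro!: ennreal_leI)
        qed
      qed
    qed (use C1 C2 R in \<open>auto intro!: borel_measurable_times_ennreal borel_measurable_indicator\<close>)
    also have "(2 powr m * R powr - m) * (C1 * (R/2) powr (?d - s)) + ((2 powr s * R powr - s) * C2 + 0 * 0)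
      = 2 powr m * 2 powr (s - ?d) * C1 * R powr (?d - s - m) + 2 powr s * C2 * R powr - s"
      using half[of "s - ?d"] R by (simp add: powr_add[symmetric] mult_ac)
    also have "ennreal \<dots> \<le> ennreal (2 powr m * 2 powr (s - ?d) * C1 * R powr - s + 2 powr s * C2 * R powr - s)"
      using R m C1 C2 by (intro ennreal_leI add_mono mult_left_mono powr_mono) auto
    finally show ?thesis by (simp add: R_def algebra_simps)
  qed
  moreover have "?C > 0" using C1 C2 by (simp add: add_pos_pos)
  ultimately show ?thesis by blast
qed

text \<open>The weight is no longer integrable, so the far region is split again at |y| = 2R, where
  R = 1 + |x|. For |y| <= 2R the kernel is at most a multiple of R^(-s) and |y|^(-k) integrates to
  R^(d-k). Beyond, |x-y| >= |y|/2 and the product is of order |y|^(-s-k), integrable at infinity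
  because s + k > d. Each region contributes R^(d-s-k).\<close>

lemma convolution_weight_bound:
  assumes s: "0 < s" "s < real DIM('a::euclidean_space)" and k: "0 < k" "k < real DIM('a)"
    and sk: "real DIM('a) < s + k"
  shows "\<exists>C>0. \<forall>x::'a. (\<integral>\<^sup>+y. ennreal ((1 + norm y) powr - k * norm (x - y) powr - s) \<partial>lborel)
    \<le> ennreal (C * (1 + norm x) powr (real DIM('a) - s - k))"
proof -
  let ?d = "real DIM('a)"
  obtain C1 where C1: "C1 > 0" "\<And>(x::'a) R. R > 0 \<Longrightarrow>
    (\<integral>\<^sup>+y. ennreal (norm (x - y) powr - s) * indicator (cball x R) y \<partial>lborel)
      \<le> ennreal (C1 * R powr (?d - s))"
    using nn_integral_powr_cball[OF s] by blast
  obtain C2 where C2: "C2 > 0" "\<And>(x::'a) R. R > 0 \<Longrightarrow>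
    (\<integral>\<^sup>+y. ennreal (norm (x - y) powr - k) * indicator (cball x R) y \<partial>lborel)
      \<le> ennreal (C2 * R powr (?d - k))"
    using nn_integral_powr_cball[OF k] by blast
  obtain C3 where C3: "C3 > 0" "\<And>(x::'a) R. R > 0 \<Longrightarrow>
    (\<integral>\<^sup>+y. ennreal (norm (x - y) powr - (s + k)) * indicator (- ball x R) y \<partial>lborel)
      \<le> ennreal (C3 * R powr (?d - (s + k)))"
    using nn_integral_powr_outside_ball[OF sk] by blast
  let ?C = "2 powr k * 2 powr (s - ?d) * C1 + 2 powr s * 2 powr (?d - k) * C2 + 2 powr s * C3"
  have "(\<integral>\<^sup>+y. ennreal ((1 + norm y) powr - k * norm (x - y) powr - s) \<partial>lborel)
    \<le> ennreal (?C * (1 + norm x) powr (?d - s - k))" for x :: 'a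
  proof -
    define R where "R = 1 + norm x"
    have R: "R \<ge> 1" by (simp add: R_def)
    have half: "(R / 2) powr - e = 2 powr e * R powr - e" for e
      using R by (simp add: powr_divide powr_minus field_simps)
    let ?rhs = "\<lambda>y. ennreal (2 powr k * R powr - k) * (ennreal (norm (x - y) powr - s) * indicator (cball x (R/2)) y)
         + (ennreal (2 powr s * R powr - s) * (ennreal (norm (0 - y) powr - k) * indicator (cball 0 (2*R)) y)
           + ennreal (2 powr s) * (ennreal (norm (0 - y) powr - (s + k)) * indicator (- ball 0 R) y))"
    have "(\<integral>\<^sup>+y. ennreal ((1 + norm y) powr - k * norm (x - y) powr - s) \<partial>lborel)
      \<le> ennreal ((2 powr k * R powr - k) * (C1 * (R/2) powr (?d - s)) +
          ((2 powr s * R powr - s) * (C2 * (2*R) powr (?d - k)) + 2 powr s * (C3 * R powr (?d - (s + k)))))"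
    proof (rule nn_integral_le_add3[where ?g1.0="\<lambda>y. ennreal (norm (x - y) powr - s) * indicator (cball x (R/2)) y"
            and ?g2.0="\<lambda>y. ennreal (norm (0 - y) powr - k) * indicator (cball 0 (2*R)) y"
            and ?g3.0="\<lambda>y. ennreal (norm (0 - y) powr - (s + k)) * indicator (- ball 0 R) y"])
      show "AE y in lborel. ennreal ((1 + norm y) powr - k * norm (x - y) powr - s) \<le> ?rhs y"
      \<comment> \<open>The weight is compared with \<open>norm y powr - k\<close>, which is 0 at
        the origin, so the origin has to be removed.\<close>
      proof (rule AE_mp[OF AE_lborel_singleton[of 0]], rule AE_I2, rule impI)
        fix y :: 'a assume y0: "y \<noteq> 0"
        show "ennreal ((1 + norm y) powr - k * norm (x - y) powr - s) \<le> ?rhs y"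
        proof (cases "norm (x - y) \<le> R / 2")
          case True
          have "R / 2 \<le> 1 + norm y" using True norm_triangle_ineq2[of x y] by (simp add: R_def)
          then have "(1 + norm y) powr - k \<le> (R / 2) powr - k"
            by (intro powr_mono2') (use R k in auto)
          then have "(1 + norm y) powr - k * norm (x - y) powr - s \<le> (2 powr k * R powr - k) * norm (x - y) powr - s"
            unfolding half by (rule mult_right_mono) auto
          then show ?thesis using True
            by (auto simp: ennreal_mult[symmetric] dist_norm intro!: add_increasing2 ennreal_leI)
        next
          case False
          have yk: "(1 + norm y) powr - k \<le> norm y powr - k"
            by (intro powr_mono2') (use y0 k in auto)
          show ?thesis
          proof (cases "norm y \<le> 2 * R")
            case True
            have "norm (x - y) powr - s \<le> (R / 2) powr - s"
              by (intro powr_mono2') (use R s False in auto)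
            with yk have "(1 + norm y) powr - k * norm (x - y) powr - s \<le> norm y powr - k * (2 powr s * R powr - s)"
              unfolding half by (intro mult_mono) auto
            then have "ennreal ((1 + norm y) powr - k * norm (x - y) powr - s)
              \<le> ennreal (2 powr s * R powr - s) * (ennreal (norm (0 - y) powr - k) * indicator (cball 0 (2*R)) y)"
              using True by (simp add: ennreal_mult[symmetric] mult_ac ennreal_leI)
            then show ?thesis by (rule order_trans) (simp add: add_increasing add_increasing2)
          next
            case F2: False
            then have "norm y / 2 \<le> norm (x - y)" using norm_triangle_ineq2[of y x]
              by (simp add: R_def norm_minus_commute)
            then have "norm (x - y) powr - s \<le> (norm y / 2) powr - s"
              by (intro powr_mono2') (use s y0 in auto)
            also have "\<dots> = 2 powr s * norm y powr - s" 
              using y0 by (simp add: powr_divide powr_minus field_simps)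
            finally have "(1 + norm y) powr - k * norm (x - y) powr - s \<le> norm y powr - k * (2 powr s * norm y powr - s)"
              using yk by (intro mult_mono) auto
            also have "\<dots> = 2 powr s * norm y powr - (s + k)"
              using y0 by (simp add: powr_add[symmetric] algebra_simps)
            finally show ?thesis using F2 R
              by (auto simp: ennreal_mult[symmetric] dist_norm mult_ac intro!: add_increasing ennreal_leI)
          qed
        qed
      qed
      show "(\<integral>\<^sup>+ y. ennreal (norm (x - y) powr - s) * indicator (cball x (R/2)) y \<partial>lborel)
        \<le> ennreal (C1 * (R/2) powr (?d - s))" by (rule C1(2)) (use R in auto)
      show "(\<integral>\<^sup>+ y. ennreal (norm (0 - y) powr - k) * indicator (cball (0::'a) (2*R)) y \<partial>lborel)
        \<le> ennreal (C2 * (2*R) powr (?d - k))" by (rule C2(2)) (use R in auto)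
      show "(\<integral>\<^sup>+ y. ennreal (norm (0 - y) powr - (s+k)) * indicator (- ball (0::'a) R) y \<partial>lborel)
        \<le> ennreal (C3 * R powr (?d - (s+k)))" by (rule C3(2)) (use R in auto)
    qed (use C1 C2 C3 in \<open>auto intro!: borel_measurable_times_ennreal borel_measurable_indicator\<close>)
    also have "(2 powr k * R powr - k) * (C1 * (R/2) powr (?d - s)) +
          ((2 powr s * R powr - s) * (C2 * (2*R) powr (?d - k)) + 2 powr s * (C3 * R powr (?d - (s + k))))
        = ?C * R powr (?d - s - k)"
    proof -
      have 1: "R powr - k * (R/2) powr (?d - s) = 2 powr (s - ?d) * R powr (?d - s - k)"
        using half[of "s - ?d"] R by (simp add: powr_add[symmetric] mult_ac)
      have e: "?d - k - s = ?d - s - k" by simp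
      have 2: "R powr - s * (2*R) powr (?d - k) = 2 powr (?d - k) * R powr (?d - s - k)"
        using R by (simp add: powr_mult powr_add[symmetric] mult_ac e)
      have "(2 powr k * R powr - k) * (C1 * (R/2) powr (?d - s)) +
          ((2 powr s * R powr - s) * (C2 * (2*R) powr (?d - k)) + 2 powr s * (C3 * R powr (?d - (s + k))))
        = 2 powr k * C1 * (R powr - k * (R/2) powr (?d - s)) +
          (2 powr s * C2 * (R powr - s * (2*R) powr (?d - k)) + 2 powr s * C3 * R powr (?d - s - k))"
        by (simp add: mult_ac diff_diff_eq)
      then show ?thesis unfolding 1 2 by (simp add: algebra_simps)
    qed
    finally show ?thesis by (simp add: R_def)
  qed
  moreover have "?C > 0" using C1 C2 C3 by (simp add: add_pos_pos)
  ultimately show ?thesis by blast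
qed

text \<open>The exponent may have either sign, which the minimum absorbs. The factor 5 fits the
  annuli 2r <= |y| <= 4r with r = 1 + |x|: there both 1 + |y| and |x-y| lie in [r, 5r].\<close>

lemma powr_ge_on_dilated_interval:
  fixes r t :: real
  assumes "0 < r" "r \<le> t" "t \<le> 5 * r"
  shows "min 1 (5 powr e) * r powr e \<le> t powr e"
proof (cases "e \<ge> 0")
  case True
  have "min 1 (5 powr e) * r powr e \<le> 1 * r powr e" by (rule mult_right_mono) auto
  also have "\<dots> \<le> t powr e" using assms True by (simp add: powr_mono2)
  finally show ?thesis .
next
  case False
  have "min 1 (5 powr e) * r powr e \<le> 5 powr e * r powr e" by (rule mult_right_mono) auto
  also have "\<dots> = (5 * r) powr e" using assms by (simp add: powr_mult)
  also have "\<dots> \<le> t powr e" using assms False by (intro powr_mono2') auto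
  finally show ?thesis .
qed

text \<open>Only the annulus of size 1 + |x| is kept; weight, kernel and volume there contribute the
  exponents -m, -s and d. The isometric \<open>\<phi>\<close> covers both the identity of the
  boundary and the embedding of the boundary into the closed half space.\<close>

lemma convolution_weight_ge:
  fixes \<phi> :: "'a::euclidean_space \<Rightarrow> 'b::real_normed_vector"
  assumes \<phi>: "\<And>y. norm (\<phi> y) = norm y"
  shows "\<exists>c>0. \<forall>x. ennreal (c * (1 + norm x) powr (real DIM('a) - m - s))
    \<le> (\<integral>\<^sup>+y. ennreal ((1 + norm y) powr - m * norm (x - \<phi> y) powr - s) \<partial>lborel)"
proof -
  let ?d = "real DIM('a)"
  define c where "c = min 1 (5 powr - m) * min 1 (5 powr - s)"
  have c: "c > 0" by (simp add: c_def)
  have "ennreal (c * unit_ball_vol ?d * (1 + norm x) powr (?d - m - s))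
    \<le> (\<integral>\<^sup>+y. ennreal ((1 + norm y) powr - m * norm (x - \<phi> y) powr - s) \<partial>lborel)" for x
  proof -
    define r where "r = 1 + norm x"
    have r: "r \<ge> 1" by (simp add: r_def)
    have "ennreal ((c * r powr - m * r powr - s) * unit_ball_vol DIM('a) * r powr DIM('a))
      \<le> (\<integral>\<^sup>+y. ennreal ((1 + norm y) powr - m * norm (x - \<phi> y) powr - s) \<partial>lborel)"
    proof (rule nn_integral_annulus_ge, intro AE_I2 impI)
      fix y :: 'a assume y: "2 * r \<le> norm y" "norm y \<le> 4 * r"
      have "min 1 (5 powr - m) * r powr - m \<le> (1 + norm y) powr - m"
        by (rule powr_ge_on_dilated_interval) (use y r in auto)
      moreover have "min 1 (5 powr - s) * r powr - s \<le> norm (x - \<phi> y) powr - s"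
      proof (rule powr_ge_on_dilated_interval)
        show "r \<le> norm (x - \<phi> y)" using norm_triangle_ineq2[of "\<phi> y" x] y r
          by (simp add: \<phi> norm_minus_commute r_def)
        show "norm (x - \<phi> y) \<le> 5 * r" using norm_triangle_ineq4[of x "\<phi> y"] y r by (simp add: \<phi> r_def)
      qed (use r in auto)
      ultimately have "(min 1 (5 powr - m) * r powr - m) * (min 1 (5 powr - s) * r powr - s)
          \<le> (1 + norm y) powr - m * norm (x - \<phi> y) powr - s" 
        by (intro mult_mono) auto
      then show "ennreal (c * r powr - m * r powr - s) \<le> ennreal ((1 + norm y) powr - m * norm (x - \<phi> y) powr - s)"
        by (intro ennreal_leI) (simp add: c_def mult_ac)
    qed (use r c in auto)
    also have "(c * r powr - m * r powr - s) * unit_ball_vol DIM('a) * r powr DIM('a)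
       = c * unit_ball_vol ?d * r powr (?d - m - s)"
      using r by (simp add: powr_diff powr_minus powr_add field_simps)
    finally show ?thesis by (simp add: r_def)
  qed
  moreover have "c * unit_ball_vol ?d > 0" using c by simp
  ultimately show ?thesis by blast
qed

text \<open>Only the fixed annulus 2 <= |y| <= 4 is kept. The weight is bounded below on it and
  |x-y| <= 4 (1 + |x|), so the decay of the kernel survives whatever m is.\<close>

lemma convolution_weight_ge_decay:
  assumes s: "s > 0"
  shows "\<exists>c>0. \<forall>x::'a::euclidean_space. ennreal (c * (1 + norm x) powr - s)
    \<le> (\<integral>\<^sup>+y. ennreal ((1 + norm y) powr - m * norm (x - y) powr - s) \<partial>lborel)"
proof -
  define c where "c = min 1 (5 powr - m) * 4 powr - s"
  have c: "c > 0" by (simp add: c_def)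
  have "ennreal (c * unit_ball_vol DIM('a) * (1 + norm x) powr - s)
    \<le> (\<integral>\<^sup>+y. ennreal ((1 + norm y) powr - m * norm (x - y) powr - s) \<partial>lborel)" for x :: 'a
  proof -
    have "ennreal ((c * (1 + norm x) powr - s) * unit_ball_vol DIM('a) * 1 powr DIM('a))
      \<le> (\<integral>\<^sup>+y. ennreal ((1 + norm y) powr - m * norm (x - y) powr - s) \<partial>lborel)"
    \<comment> \<open>The point \<open>y = x\<close> must be excluded because \<open>0 powr - s = 0\<close>.\<close>
    proof (rule nn_integral_annulus_ge, rule AE_mp[OF AE_lborel_singleton[of x]], intro AE_I2 impI)
      fix y :: 'a assume y: "2 * 1 \<le> norm y" "norm y \<le> 4 * 1" "y \<noteq> x"
      have "min 1 (5 powr - m) * 1 powr - m \<le> (1 + norm y) powr - m"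
        by (rule powr_ge_on_dilated_interval) (use y in auto)
      moreover have "(4 * (1 + norm x)) powr - s \<le> norm (x - y) powr - s"
        by (rule powr_mono2') (use s y norm_triangle_ineq4[of x y] norm_ge_zero[of x] in \<open>auto simp del: norm_ge_zero\<close>)
      ultimately have "min 1 (5 powr - m) * (4 powr - s * (1 + norm x) powr - s)
         \<le> (1 + norm y) powr - m * norm (x - y) powr - s"
        by (intro mult_mono) (auto simp: powr_mult simp del: distrib_left_numeral)
      then show "ennreal (c * (1 + norm x) powr - s) \<le> ennreal ((1 + norm y) powr - m * norm (x - y) powr - s)"
        by (intro ennreal_leI) (simp add: c_def mult_ac)
    qed (use c in auto)
    then show ?thesis by (simp add: mult_ac)
  qed
  moreover have "c * unit_ball_vol DIM('a) > 0" using c by simp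
  ultimately show ?thesis by blast
qed

subsection \<open>Nonexistence\<close>

lemma sigmaN_pos: "sigmaN TYPE('b::euclidean_space) > 0"
  by (simp add: sigmaN_def content_ball)

lemma AE_lebesgue_ex_in_open:
  fixes S :: "'b::euclidean_space set"
  assumes P: "AE x in lebesgue. P x" and S: "open S" "S \<noteq> {}"
  shows "\<exists>x\<in>S. P x"
proof (rule ccontr)
  assume contra: "\<not> (\<exists>x\<in>S. P x)"
  have "AE x in lborel. P x" using P by (simp add: AE_completion_iff)
  then obtain N where N: "{x \<in> space lborel. \<not> P x} \<subseteq> N" "emeasure lborel N = 0" "N \<in> sets lborel"
    by (rule AE_E)
  obtain x e where e: "e > 0" "ball x e \<subseteq> S" using S open_contains_ball by blast
  have "ball x e \<subseteq> N" using e contra N(1) by auto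
  then have "emeasure lborel (ball x e) \<le> emeasure lborel N" using N(3) by (intro emeasure_mono) auto
  moreover have "unit_ball_vol (real DIM('b)) > 0" by simp
  then have "unit_ball_vol (real DIM('b)) \<noteq> 0" by linarith
  ultimately show False using N(2) e(1) by (simp add: emeasure_ball)
qed

text \<open>The set where the inequality holds has full measure in the half space, so it meets every
  small half ball and accumulates at the boundary point. The limit of \<open>u\<close> may then be
  taken along that set. The codomain is general because the lemma is applied to real traces and to
  \<open>ennreal\<close> potentials.\<close>

lemma boundary_limit_of_upper_half:
  fixes u f :: "'a::euclidean_space \<times> real \<Rightarrow> 'c::linorder_topology"
  assumes ge: "AE x in lebesgue. x \<in> upper_half \<longrightarrow> f x \<le> u x"
    and f: "isCont f (x', 0)"
    and lim: "(u \<longlongrightarrow> u (x', 0)) (at (x', 0) within upper_half)"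
  shows "f (x', 0) \<le> u (x', 0)"
proof -
  define S where "S = {x \<in> upper_half. f x \<le> u x}"
  have "at (x', 0) within S \<noteq> bot"
  proof -
    have "\<exists>z\<in>S. z \<noteq> (x', 0) \<and> dist z (x', 0) < e" if e: "e > 0" for e
    proof -
      have op: "open (upper_half \<inter> ball (x', 0::real) e)"
        unfolding upper_half_def by (intro open_Int open_ball open_Collect_less continuous_intros)
      have "(x', e / 2) \<in> upper_half \<inter> ball (x', 0::real) e"
        using e by (auto simp: upper_half_def dist_Pair_Pair)
      then obtain z where z: "z \<in> upper_half \<inter> ball (x', 0) e" "z \<in> upper_half \<longrightarrow> f z \<le> u z"
        using AE_lebesgue_ex_in_open[OF ge op] by blast
      then have "z \<in> S" "z \<noteq> (x', 0)" by (auto simp: S_def upper_half_def)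
      with z show ?thesis by (auto simp: dist_commute)
    qed
    then have "(x', 0) islimpt S" by (simp add: islimpt_approachable)
    then show ?thesis by (simp add: trivial_limit_within)
  qed
  then show ?thesis
  proof (rule tendsto_le)
    show "(u \<longlongrightarrow> u (x', 0)) (at (x', 0) within S)"
      by (rule tendsto_within_subset[OF lim]) (auto simp: S_def)
    show "(f \<longlongrightarrow> f (x', 0)) (at (x', 0) within S)"
      using f by (simp add: isCont_def tendsto_within_subset[of f _ _ UNIV])
    show "\<forall>\<^sub>F x in at (x', 0) within S. f x \<le> u x"
      by (auto simp: eventually_at_filter S_def)
  qed
qed

lemma PhiE_ge:
  fixes z :: "'b::euclidean_space"
  assumes "DIM('b) \<ge> 3" "norm z \<le> t" "t > 0"
  shows "ennreal (1 / ((real DIM('b) - 2) * sigmaN TYPE('b)) * t powr (2 - real DIM('b))) \<le> PhiE z"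
proof (cases "z = 0")
  case False
  have "t powr (2 - real DIM('b)) \<le> norm z powr (2 - real DIM('b))"
    by (rule powr_mono2') (use assms False in auto)
  then show ?thesis using False assms sigmaN_pos[where 'b='b]
    by (auto simp: PhiE_def intro!: ennreal_leI divide_right_mono)
qed (simp add: PhiE_def)

text \<open>Some ball of radius n about 0 carries positive mass, and |x-y| <= (1 + n)(1 + |x|) for y
  in it. The exponent d - 1 is N - 2, and the unreflected half of the Green function
  suffices.\<close>

lemma green_potential_ge:
  fixes \<mu> :: "('a::euclidean_space \<times> real) measure"
  assumes N3: "DIM('a) \<ge> 2" and radon: "radon_measure \<mu>" and nz: "emeasure \<mu> (space \<mu>) \<noteq> 0"
  shows "\<exists>c>0. \<forall>x. ennreal (c * (1 + norm x) powr - (real DIM('a) - 1)) \<le> (\<integral>\<^sup>+ y. greenN x y \<partial>\<mu>)"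
proof -
  let ?d = "real DIM('a)"
  define K where "K = 1 / ((real DIM('a \<times> real) - 2) * sigmaN TYPE('a \<times> real))"
  have K: "K > 0" using N3 sigmaN_pos[where 'b="'a \<times> real"] by (simp add: K_def)
  have sets[simp, measurable_cong]: "sets \<mu> = sets borel" using radon by (simp add: radon_measure_def)
  then have sp: "space \<mu> = UNIV" using sets_eq_imp_space_eq by fastforce
  have "\<exists>n::nat. emeasure \<mu> (cball 0 (real n)) \<noteq> 0"
  proof (rule ccontr)
    assume "\<not> ?thesis"
    then have "(\<Union>n::nat. cball 0 (real n)) \<in> null_sets \<mu>" by (intro null_sets_UN) auto
    moreover have "(\<Union>n::nat. cball (0::'a \<times> real) (real n)) = UNIV"
      by (auto simp: real_arch_simple)
    ultimately show False using nz sp by auto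
  qed
  then obtain n where n: "emeasure \<mu> (cball 0 (real n)) \<noteq> 0" by blast
  have "emeasure \<mu> (cball 0 (real n)) < \<infinity>" using radon by (simp add: radon_measure_def)
  \<comment> \<open>Local finiteness of the measure makes the mass of the ball a real
    number.\<close>
  with n obtain b where b: "emeasure \<mu> (cball 0 (real n)) = ennreal b" "b > 0"
    by (metis ennreal_cases ennreal_neg infinity_ennreal_def leI less_irrefl)
  define c where "c = K * (1 + real n) powr (1 - ?d) * b"
  have "ennreal (c * (1 + norm x) powr - (?d - 1)) \<le> (\<integral>\<^sup>+ y. greenN x y \<partial>\<mu>)" for x
  proof -
    define t where "t = (1 + real n) * (1 + norm x)"
    have t: "t > 0" by (simp add: t_def add_pos_nonneg)
    have "ennreal (c * (1 + norm x) powr - (?d - 1)) = ennreal (K * t powr (1 - ?d)) * ennreal b"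
      using K b by (simp add: c_def t_def powr_mult ennreal_mult[symmetric] mult_ac)
    also have "\<dots> = (\<integral>\<^sup>+ y. ennreal (K * t powr (1 - ?d)) * indicator (cball 0 (real n)) y \<partial>\<mu>)"
      by (simp add: nn_integral_cmult_indicator b)
    also have "\<dots> \<le> (\<integral>\<^sup>+ y. greenN x y \<partial>\<mu>)"
    proof (rule nn_integral_mono)
      fix y
      show "ennreal (K * t powr (1 - ?d)) * indicator (cball 0 (real n)) y \<le> greenN x y"
      proof (cases "y \<in> cball 0 (real n)")
        case True
        have "norm (x - y) \<le> norm x + real n" using True norm_triangle_ineq4[of x y] by simp
        also have "\<dots> \<le> t" by (simp add: t_def algebra_simps)
        finally have "ennreal (K * t powr (1 - ?d)) \<le> PhiE (x - y)"
          using PhiE_ge[of "x - y" t] t N3 by (simp add: K_def)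
        also have "\<dots> \<le> greenN x y" by (simp add: greenN_def)
        finally show ?thesis using True by simp
      qed simp
    qed
    finally show ?thesis .
  qed
  moreover have "c > 0" using K b by (simp add: c_def)
  ultimately show ?thesis by blast
qed

section \<open>Admissible rates of a positive solution\<close>

text \<open>A smaller \<open>a\<close> is a stronger bound, so improving a rate means lowering it.
  No sign is imposed on \<open>a\<close>; positivity of the rates is a consequence of finiteness of
  \<open>H_u\<close>.\<close>

definition trace_rate :: "('a::euclidean_space \<times> real \<Rightarrow> real) \<Rightarrow> real \<Rightarrow> bool" where
  "trace_rate u a \<longleftrightarrow> (\<exists>c>0. AE x' in lborel. c * (1 + norm x') powr - a \<le> u (x', 0))"

lemma trace_rate_powr:
  assumes "trace_rate u a" "p > 0"
  obtains c where "c > 0" "AE x' in lborel. c * (1 + norm x') powr - (p * a) \<le> u (x', 0) powr p"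
proof -
  obtain c where c: "c > 0" "AE x' in lborel. c * (1 + norm x') powr - a \<le> u (x', 0)"
    using assms by (auto simp: trace_rate_def)
  have "AE x' in lborel. c powr p * (1 + norm x') powr - (p * a) \<le> u (x', 0) powr p"
    using c(2)
  proof eventually_elim
    fix x' assume "c * (1 + norm x') powr - a \<le> u (x', 0)"
    then have "(c * (1 + norm x') powr - a) powr p \<le> u (x', 0) powr p"
      using c(1) assms(2) by (intro powr_mono2) auto
    then show "c powr p * (1 + norm x') powr - (p * a) \<le> u (x', 0) powr p"
      using c(1) by (simp add: powr_mult powr_powr mult_ac)
  qed
  then show thesis using that[of "c powr p"] c(1) by simp
qed

text \<open>The parameter \<open>A\<close> stands for the outer kernel factor |x-(y,0)|^(d-1), which
  the definition of a solution keeps inside the inner integral; \<open>A = 1\<close> gives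
  \<open>H_u\<close>. At \<open>A = 0\<close> both sides vanish by the convention for division. The
  constant depends on neither \<open>A\<close> nor \<open>y\<close>.\<close>

lemma trace_rate_integral_ge:
  fixes u :: "'a::euclidean_space \<times> real \<Rightarrow> real"
  assumes "trace_rate u a" "p > 0"
  shows "\<exists>c>0. \<forall>A\<ge>0. \<forall>y. ennreal (c / A) * (\<integral>\<^sup>+z. ennreal ((1 + norm z) powr - (p * a) * norm (y - z) powr - k) \<partial>lborel)
    \<le> (\<integral>\<^sup>+z. ennreal (u (z, 0) powr p / (A * norm (y - z) powr k)) \<partial>lborel)"
proof -
  obtain c where c: "c > 0" "AE x' in lborel. c * (1 + norm x') powr - (p * a) \<le> u (x', 0) powr p"
    using trace_rate_powr[OF assms] .
  have "ennreal (c / A) * (\<integral>\<^sup>+z. ennreal ((1 + norm z) powr - (p * a) * norm (y - z) powr - k) \<partial>lborel)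
    \<le> (\<integral>\<^sup>+z. ennreal (u (z, 0) powr p / (A * norm (y - z) powr k)) \<partial>lborel)" if A: "A \<ge> 0" for A y
  proof -
    have "ennreal (c / A) * (\<integral>\<^sup>+z. ennreal ((1 + norm z) powr - (p * a) * norm (y - z) powr - k) \<partial>lborel)
      = (\<integral>\<^sup>+z. ennreal (c / A) * ennreal ((1 + norm z) powr - (p * a) * norm (y - z) powr - k) \<partial>lborel)"
      by (rule nn_integral_cmult[symmetric]) measurable
    also have "\<dots> \<le> (\<integral>\<^sup>+z. ennreal (u (z, 0) powr p / (A * norm (y - z) powr k)) \<partial>lborel)"
    proof (rule nn_integral_mono_AE)
      show "AE z in lborel. ennreal (c / A) * ennreal ((1 + norm z) powr - (p * a) * norm (y - z) powr - k)
         \<le> ennreal (u (z, 0) powr p / (A * norm (y - z) powr k))"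
        using c(2)
      proof eventually_elim
        fix z assume "c * (1 + norm z) powr - (p * a) \<le> u (z, 0) powr p"
        then have "(c * (1 + norm z) powr - (p * a)) * (norm (y - z) powr - k / A)
            \<le> u (z, 0) powr p * (norm (y - z) powr - k / A)"
          using A by (intro mult_right_mono) auto
        then show "ennreal (c / A) * ennreal ((1 + norm z) powr - (p * a) * norm (y - z) powr - k)
          \<le> ennreal (u (z, 0) powr p / (A * norm (y - z) powr k))"
          using A c(1) by (subst ennreal_mult[symmetric]) (auto simp: powr_minus field_simps intro!: ennreal_leI)
      qed
    qed
    finally show ?thesis .
  qed
  with c(1) show ?thesis by blast
qed

context
  fixes \<mu> :: "('a::euclidean_space \<times> real) measure" and k p lam :: real and u
  assumes N3: "DIM('a) \<ge> 2" and k_pos: "0 < k" and k_lt: "k < real DIM('a)" and p_pos: "0 < p"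
    and lam: "lam > 0" and sol: "pos_sol \<mu> lam p k u"
begin

text \<open>The representation in the form fitting the convolution estimates: N - 2 is written as d
  - 1, and \<open>lborel\<close> replaces its completion.\<close>

lemma pos_sol_representation:
  "AE x in lebesgue. x \<in> upper_half \<longrightarrow>
        ennreal (u x) = (\<integral>\<^sup>+ y. greenN x y \<partial>\<mu>) +
          ennreal (2 * lam / ((real DIM('a) - 1) * sigmaN TYPE('a \<times> real))) *
          (\<integral>\<^sup>+ y'. \<integral>\<^sup>+ z'. ennreal (u (z', 0) powr p /
              (norm (x - (y', 0)) powr (real DIM('a) - 1) * norm (y' - z') powr k))
            \<partial>lborel \<partial>lborel)"
  using sol by (simp add: pos_sol_def nn_integral_completion)

lemma trace_rate_of_lower_bound:
  assumes c: "c > 0" and ge: "AE x in lebesgue. x \<in> upper_half \<longrightarrow> ennreal (c * (1 + norm x) powr - a) \<le> ennreal (u x)"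
  shows "trace_rate u a"
proof -
  have "AE x' in lebesgue. (u \<longlongrightarrow> u (x', 0)) (at (x', 0) within upper_half)"
    using sol by (simp add: pos_sol_def)
  then have "AE x' in lebesgue. c * (1 + norm x') powr - a \<le> u (x', 0)"
  proof eventually_elim
    fix x' :: 'a assume lim: "(u \<longlongrightarrow> u (x', 0)) (at (x', 0) within upper_half)"
    have "AE x in lebesgue. x \<in> upper_half \<longrightarrow> c * (1 + norm x) powr - a \<le> u x"
      using ge
    proof eventually_elim
      fix x :: "'a \<times> real" 
      \<comment> \<open>\<open>ennreal\<close> truncates negative values of \<open>u\<close>; a
        positive lower bound lets the comparison return to the reals.\<close>
      have "c * (1 + norm x) powr - a > 0" using c by (simp add: add_nonneg_eq_0_iff)
      then show "x \<in> upper_half \<longrightarrow> ennreal (c * (1 + norm x) powr - a) \<le> ennreal (u x) \<Longrightarrow>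
         x \<in> upper_half \<longrightarrow> c * (1 + norm x) powr - a \<le> u x" by (auto simp: ennreal_le_iff2)
    qed
    moreover have "isCont (\<lambda>x. c * (1 + norm x) powr - a) (x', 0)"
      by (intro continuous_intros) (simp add: add_nonneg_eq_0_iff)
    ultimately have "c * (1 + norm (x', 0::real)) powr - a \<le> u (x', 0)"
      using lim by (rule boundary_limit_of_upper_half)
    then show "c * (1 + norm x') powr - a \<le> u (x', 0)" by (simp add: norm_Pair)
  qed
  then show ?thesis using c by (auto simp: trace_rate_def AE_completion_iff)
qed

lemma trace_rate_green:
  assumes "radon_measure \<mu>" "emeasure \<mu> (space \<mu>) \<noteq> 0"
  shows "trace_rate u (real DIM('a) - 1)"
proof -
  obtain c where c: "c > 0" "\<And>x. ennreal (c * (1 + norm x) powr - (real DIM('a) - 1)) \<le> (\<integral>\<^sup>+ y. greenN x y \<partial>\<mu>)"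
    using green_potential_ge[OF N3 assms] by blast
  show ?thesis
  proof (rule trace_rate_of_lower_bound[OF c(1)])
    show "AE x in lebesgue. x \<in> upper_half \<longrightarrow> ennreal (c * (1 + norm x) powr - (real DIM('a) - 1)) \<le> ennreal (u x)"
      using pos_sol_representation
    proof eventually_elim
      fix x :: "'a \<times> real" 
      show "x \<in> upper_half \<longrightarrow>
        ennreal (u x) = (\<integral>\<^sup>+ y. greenN x y \<partial>\<mu>) +
          ennreal (2 * lam / ((real DIM('a) - 1) * sigmaN TYPE('a \<times> real))) *
          (\<integral>\<^sup>+ y'. \<integral>\<^sup>+ z'. ennreal (u (z', 0) powr p /
              (norm (x - (y', 0)) powr (real DIM('a) - 1) * norm (y' - z') powr k))
            \<partial>lborel \<partial>lborel) \<Longrightarrow> x \<in> upper_half \<longrightarrow> ennreal (c * (1 + norm x) powr - (real DIM('a) - 1)) \<le> ennreal (u x)"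
        using c(2)[of x] by (auto intro: add_increasing2)
    qed
  qed
qed

text \<open>If the inner convolution decays no faster than (1 + |y|)^(-q), the outer kernel of
  exponent d - 1 yields d - q - (d - 1) = -(q - 1). The inner bound is left abstract because both
  improvements, q = k and q = p a + k - d, pass through this step.\<close>

lemma trace_rate_improve:
  assumes a: "trace_rate u a"
    and b: "b > 0" "\<And>y::'a. ennreal (b * (1 + norm y) powr - q)
      \<le> (\<integral>\<^sup>+z. ennreal ((1 + norm z) powr - (p * a) * norm (y - z) powr - k) \<partial>lborel)"
  shows "trace_rate u (q - 1)"
proof -
  define K where "K = 2 * lam / ((real DIM('a) - 1) * sigmaN TYPE('a \<times> real))"
  have K: "K > 0" using N3 lam sigmaN_pos[where 'b="'a \<times> real"] by (simp add: K_def)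
  obtain c where c: "c > 0" "\<And>A y. A \<ge> 0 \<Longrightarrow> ennreal (c / A) * (\<integral>\<^sup>+z. ennreal ((1 + norm z) powr - (p * a) * norm (y - z) powr - k) \<partial>lborel)
    \<le> (\<integral>\<^sup>+z. ennreal (u (z, 0) powr p / (A * norm (y - z) powr k)) \<partial>lborel)"
    using trace_rate_integral_ge[OF a p_pos, of k] by blast
  have embed: "norm (y, 0::real) = norm y" for y :: 'a by (simp add: norm_Pair)
  obtain e where e: "e > 0" "\<And>x::'a \<times> real. ennreal (e * (1 + norm x) powr (real DIM('a) - q - (real DIM('a) - 1)))
    \<le> (\<integral>\<^sup>+y. ennreal ((1 + norm y) powr - q * norm (x - (y, 0)) powr - (real DIM('a) - 1)) \<partial>lborel)"
    using convolution_weight_ge[OF embed, of q "real DIM('a) - 1"] by blast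
  have dbl: "ennreal (K * c * b * e * (1 + norm x) powr - (q - 1)) \<le> ennreal K *
     (\<integral>\<^sup>+ y'. \<integral>\<^sup>+ z'. ennreal (u (z', 0) powr p /
              (norm (x - (y', 0)) powr (real DIM('a) - 1) * norm (y' - z') powr k)) \<partial>lborel \<partial>lborel)" (is "_ \<le> _ * ?D") for x :: "'a \<times> real"
  proof -
    have "ennreal (K * c * b * e * (1 + norm x) powr - (q - 1))
      = ennreal K * (ennreal (c * b) * ennreal (e * (1 + norm x) powr (real DIM('a) - q - (real DIM('a) - 1))))"
      using K c(1) b(1) e(1) by (simp add: ennreal_mult[symmetric] mult_ac)
    also have "\<dots> \<le> ennreal K * (ennreal (c * b) * (\<integral>\<^sup>+y. ennreal ((1 + norm y) powr - q * norm (x - (y, 0)) powr - (real DIM('a) - 1)) \<partial>lborel))"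
      by (intro mult_left_mono e(2)) simp_all
    also have "\<dots> = ennreal K * (\<integral>\<^sup>+y. ennreal (c * b) * ennreal ((1 + norm y) powr - q * norm (x - (y, 0)) powr - (real DIM('a) - 1)) \<partial>lborel)"
      by (subst nn_integral_cmult) auto
    also have "\<dots> \<le> ennreal K * ?D"
    proof (intro mult_left_mono nn_integral_mono)
      fix y :: 'a
      let ?A = "norm (x - (y, 0)) powr (real DIM('a) - 1)"
      have "ennreal (c * b) * ennreal ((1 + norm y) powr - q * norm (x - (y, 0)) powr - (real DIM('a) - 1))
        = ennreal (c / ?A) * ennreal (b * (1 + norm y) powr - q)"
        using c(1) b(1) by (simp add: ennreal_mult[symmetric] powr_minus field_simps del: minus_diff_eq)
      also have "\<dots> \<le> ennreal (c / ?A) * (\<integral>\<^sup>+z. ennreal ((1 + norm z) powr - (p * a) * norm (y - z) powr - k) \<partial>lborel)"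
        by (intro mult_left_mono b(2)) auto
      also have "\<dots> \<le> (\<integral>\<^sup>+z. ennreal (u (z, 0) powr p / (?A * norm (y - z) powr k)) \<partial>lborel)"
        by (rule c(2)) simp
      finally show "ennreal (c * b) * ennreal ((1 + norm y) powr - q * norm (x - (y, 0)) powr - (real DIM('a) - 1))
         \<le> (\<integral>\<^sup>+z. ennreal (u (z, 0) powr p / (?A * norm (y - z) powr k)) \<partial>lborel)" .
    qed auto
    finally show ?thesis .
  qed
  show ?thesis
  proof (rule trace_rate_of_lower_bound)
    show "K * c * b * e > 0" using K c(1) b(1) e(1) by simp
    show "AE x in lebesgue. x \<in> upper_half \<longrightarrow> ennreal (K * c * b * e * (1 + norm x) powr - (q - 1)) \<le> ennreal (u x)"
      using pos_sol_representation
    proof eventually_elim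
      fix x :: "'a \<times> real" 
      show "x \<in> upper_half \<longrightarrow>
        ennreal (u x) = (\<integral>\<^sup>+ y. greenN x y \<partial>\<mu>) +
          ennreal (2 * lam / ((real DIM('a) - 1) * sigmaN TYPE('a \<times> real))) *
          (\<integral>\<^sup>+ y'. \<integral>\<^sup>+ z'. ennreal (u (z', 0) powr p /
              (norm (x - (y', 0)) powr (real DIM('a) - 1) * norm (y' - z') powr k))
            \<partial>lborel \<partial>lborel) \<Longrightarrow> x \<in> upper_half \<longrightarrow> ennreal (K * c * b * e * (1 + norm x) powr - (q - 1)) \<le> ennreal (u x)"
        using dbl[of x] by (auto simp: K_def intro: add_increasing)
    qed
  qed
qed

lemma trace_rate_k_minus_1:
  assumes "trace_rate u a"
  shows "trace_rate u (k - 1)"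
proof -
  obtain b where "b > 0" "\<And>y::'a. ennreal (b * (1 + norm y) powr - k)
      \<le> (\<integral>\<^sup>+z. ennreal ((1 + norm z) powr - (p * a) * norm (y - z) powr - k) \<partial>lborel)"
    using convolution_weight_ge_decay[OF k_pos, where m="p * a"] by blast
  from trace_rate_improve[OF assms this] show ?thesis .
qed

lemma trace_rate_iterate:
  assumes "trace_rate u a"
  shows "trace_rate u (p * a + k - 1 - real DIM('a))"
proof -
  obtain b where "b > 0" "\<And>y::'a. ennreal (b * (1 + norm y) powr - (p * a + k - real DIM('a)))
      \<le> (\<integral>\<^sup>+z. ennreal ((1 + norm z) powr - (p * a) * norm (y - z) powr - k) \<partial>lborel)"
    using convolution_weight_ge[of "\<lambda>y::'a. y" "p * a" k] by (auto simp: algebra_simps)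
  from trace_rate_improve[OF assms this] show ?thesis by (simp add: algebra_simps)
qed

lemma trace_rate_H_ge:
  assumes "trace_rate u a"
  shows "\<exists>c>0. \<forall>y. ennreal c * (\<integral>\<^sup>+z. ennreal ((1 + norm z) powr - (p * a) * norm (y - z) powr - k) \<partial>lborel)
    \<le> H_u u p k y"
proof -
  obtain c where c: "c > 0" "\<And>A y. A \<ge> 0 \<Longrightarrow> ennreal (c / A) * (\<integral>\<^sup>+z. ennreal ((1 + norm z) powr - (p * a) * norm (y - z) powr - k) \<partial>lborel)
    \<le> (\<integral>\<^sup>+z. ennreal (u (z, 0) powr p / (A * norm (y - z) powr k)) \<partial>lborel)"
    using trace_rate_integral_ge[OF assms p_pos, of k] by blast
  show ?thesis using c(1) c(2)[of 1] by (intro exI[of _ c]) (auto simp: H_u_def nn_integral_completion)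
qed

text \<open>If p a <= d - k, then at any fixed y the integrand of the convolution is at least 2^(-d)
  |z|^(-d) for |z| >= 1 + |y|. That diverges and makes \<open>H_u\<close> infinite at every point,
  whereas one point of finiteness already contradicts this.\<close>

lemma trace_rate_gt:
  assumes a: "trace_rate u a"
  shows "p * a > real DIM('a) - k"
proof (rule ccontr)
  assume "\<not> p * a > real DIM('a) - k"
  then have le: "p * a \<le> real DIM('a) - k" by simp
  obtain c where c: "c > 0" "\<And>y. ennreal c * (\<integral>\<^sup>+z. ennreal ((1 + norm z) powr - (p * a) * norm (y - z) powr - k) \<partial>lborel)
    \<le> H_u u p k y" using trace_rate_H_ge[OF a] by blast
  have "AE y in lebesgue. H_u u p k y < \<infinity>" using sol by (simp add: pos_sol_def)
  then obtain y where y: "H_u u p k y < \<infinity>" using AE_lebesgue_ex_in_open[of _ UNIV] by auto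
  have "(\<integral>\<^sup>+z. ennreal ((1 + norm z) powr - (p * a) * norm (y - z) powr - k) \<partial>lborel) = \<infinity>"
  proof (rule nn_integral_powr_DIM_infinite)
    show "(2::real) powr - real DIM('a) > 0" by simp
    fix z :: 'a assume z: "1 + norm y \<le> norm z"
    then have z1: "norm z \<ge> 1" by (smt (verit) norm_ge_zero)
    have "(2 * norm z) powr - (real DIM('a) - k) \<le> (1 + norm z) powr - (real DIM('a) - k)"
      by (rule powr_mono2') (use k_lt z1 in auto)
    also have "\<dots> \<le> (1 + norm z) powr - (p * a)" by (rule powr_mono) (use le in auto)
    finally have 1: "(2 * norm z) powr - (real DIM('a) - k) \<le> (1 + norm z) powr - (p * a)" .
    have "(2 * norm z) powr - k \<le> norm (y - z) powr - k"
    proof (rule powr_mono2')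
      show "0 < norm (y - z)" using z by auto
      show "norm (y - z) \<le> 2 * norm z" using z norm_triangle_ineq4[of y z] by linarith
    qed (use k_pos in auto)
    with 1 have "(2 * norm z) powr - (real DIM('a) - k) * (2 * norm z) powr - k 
       \<le> (1 + norm z) powr - (p * a) * norm (y - z) powr - k" by (intro mult_mono) auto
    moreover have "(2 * norm z) powr - (real DIM('a) - k) * (2 * norm z) powr - k = 2 powr - real DIM('a) * norm z powr - real DIM('a)"
      by (subst powr_add[symmetric]) (simp add: powr_mult)
    ultimately show "ennreal (2 powr - real DIM('a) * norm z powr - real DIM('a)) \<le> ennreal ((1 + norm z) powr - (p * a) * norm (y - z) powr - k)"
      by (simp add: ennreal_leI)
  qed
  with c(2)[of y] c(1) have "H_u u p k y = \<infinity>" by (simp add: ennreal_mult_top top_unique)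
  with y show False by simp
qed

lemma trace_rate_imp_k_gt_1:
  assumes a: "trace_rate u a" shows "k > 1"
proof (rule ccontr)
  assume "\<not> k > 1" then have k1: "k \<le> 1" by simp
  obtain c where c: "c > 0" "\<And>y. ennreal c * (\<integral>\<^sup>+z. ennreal ((1 + norm z) powr - (p * a) * norm (y - z) powr - k) \<partial>lborel)
    \<le> H_u u p k y" using trace_rate_H_ge[OF a] by blast
  obtain b where b: "b > 0" "\<And>y::'a. ennreal (b * (1 + norm y) powr - k)
      \<le> (\<integral>\<^sup>+z. ennreal ((1 + norm z) powr - (p * a) * norm (y - z) powr - k) \<partial>lborel)"
    using convolution_weight_ge_decay[OF k_pos, where m="p * a"] by blast
  have H: "ennreal (c * b * (1 + norm y) powr - k) \<le> H_u u p k y" for y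
  proof -
    have "ennreal (c * b * (1 + norm y) powr - k) = ennreal c * ennreal (b * (1 + norm y) powr - k)"
      using c(1) b(1) by (simp add: ennreal_mult[symmetric] mult_ac)
    also have "\<dots> \<le> ennreal c * (\<integral>\<^sup>+z. ennreal ((1 + norm z) powr - (p * a) * norm (y - z) powr - k) \<partial>lborel)"
      by (intro mult_left_mono b(2)) auto
    also note c(2)
    finally show ?thesis .
  qed
  have ae: "AE x in lebesgue. x \<in> upper_half \<longrightarrow>
        (\<integral>\<^sup>+ y'. H_u u p k y' * ennreal (1 / norm (x - (y', 0)) powr (real DIM('a) - 1)) \<partial>lborel) < \<infinity>"
    using sol by (simp add: pos_sol_def nn_integral_completion)
  have op: "open (upper_half :: ('a \<times> real) set)"
    unfolding upper_half_def by (intro open_Collect_less continuous_intros)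
  have "(0, 1) \<in> (upper_half :: ('a \<times> real) set)" by (simp add: upper_half_def)
  then have ne: "(upper_half :: ('a \<times> real) set) \<noteq> {}" by blast
  from AE_lebesgue_ex_in_open[OF ae op ne] obtain x :: "'a \<times> real" where
    x: "(\<integral>\<^sup>+ y'. H_u u p k y' * ennreal (1 / norm (x - (y', 0)) powr (real DIM('a) - 1)) \<partial>lborel) < \<infinity>"
    by blast
  have "(\<integral>\<^sup>+ y'. H_u u p k y' * ennreal (1 / norm (x - (y', 0)) powr (real DIM('a) - 1)) \<partial>lborel) = \<infinity>"
  proof (rule nn_integral_powr_DIM_infinite)
    show "c * b * 2 powr - (k + (real DIM('a) - 1)) > 0" using c(1) b(1) by simp
    fix y :: 'a assume y: "1 + norm x \<le> norm y"
    then have y1: "norm y \<ge> 1" by (smt (verit) norm_ge_zero)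
    have 1: "(2 * norm y) powr - k \<le> (1 + norm y) powr - k"
      by (rule powr_mono2') (use k_pos y1 in auto)
    have 2: "(2 * norm y) powr - (real DIM('a) - 1) \<le> norm (x - (y, 0)) powr - (real DIM('a) - 1)"
    proof (rule powr_mono2')
      show "0 < norm (x - (y, 0))" using y by (auto simp: norm_Pair)
      show "norm (x - (y, 0)) \<le> 2 * norm y" using y norm_triangle_ineq4[of x "(y, 0)"] by (simp add: norm_Pair)
    qed (use N3 in auto)
    \<comment> \<open>This is where k <= 1 enters: k + d - 1 <= d, and |y| >= 1, so the critical
      exponent d bounds the integrand from below.\<close>
    have "c * b * 2 powr - (k + (real DIM('a) - 1)) * norm y powr - real DIM('a)
      \<le> c * b * 2 powr - (k + (real DIM('a) - 1)) * norm y powr - (k + (real DIM('a) - 1))"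
      using k1 y1 c(1) b(1) by (intro mult_left_mono powr_mono) auto
    also have "\<dots> = c * b * ((2 * norm y) powr - k * (2 * norm y) powr - (real DIM('a) - 1))"
      using y1 by (simp add: powr_add[symmetric] powr_mult[symmetric])
    also have "\<dots> \<le> c * b * ((1 + norm y) powr - k * norm (x - (y, 0)) powr - (real DIM('a) - 1))"
      using 1 2 c(1) b(1) by (intro mult_left_mono mult_mono) auto
    finally have "ennreal (c * b * 2 powr - (k + (real DIM('a) - 1)) * norm y powr - real DIM('a))
      \<le> ennreal (c * b * (1 + norm y) powr - k) * ennreal (norm (x - (y, 0)) powr - (real DIM('a) - 1))"
      using c(1) b(1) by (simp add: ennreal_mult[symmetric] mult_ac ennreal_leI)
    also have "\<dots> \<le> H_u u p k y * ennreal (norm (x - (y, 0)) powr - (real DIM('a) - 1))"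
      by (intro mult_right_mono H) auto
    also have "norm (x - (y, 0)) powr - (real DIM('a) - 1) = 1 / norm (x - (y, 0)) powr (real DIM('a) - 1)"
      by (rule powr_minus_divide)
    finally show "ennreal (c * b * 2 powr - (k + (real DIM('a) - 1)) * norm y powr - real DIM('a))
      \<le> H_u u p k y * ennreal (1 / norm (x - (y, 0)) powr (real DIM('a) - 1))" .
  qed
  with x show False by simp
qed

lemma exponent_ge_critical:
  assumes a: "trace_rate u a"
  shows "p * (k - 1) \<ge> real DIM('a)"
proof -
  define A where "A = {a. trace_rate u a}"
  have k1: "k - 1 \<in> A" using trace_rate_k_minus_1[OF a] by (simp add: A_def)
  have lower: "(real DIM('a) - k) / p < b" if "b \<in> A" for b
    using trace_rate_gt[of b] that p_pos by (simp add: A_def field_simps)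
  then have bdd: "bdd_below A" by (intro bdd_belowI[of _ "(real DIM('a) - k) / p"]) (auto intro: less_imp_le)
  define \<alpha> where "\<alpha> = Inf A"
  have pos: "(real DIM('a) - k) / p \<le> \<alpha>" unfolding \<alpha>_def
    by (rule cInf_greatest) (use k1 lower in \<open>auto intro: less_imp_le\<close>)
  then have "\<alpha> > 0" using k_lt p_pos by (smt (verit) divide_pos_pos)
  have ub: "\<alpha> \<le> k - 1" unfolding \<alpha>_def by (rule cInf_lower[OF k1 bdd])
  \<comment> \<open>The image of every rate under the iteration is a rate, hence at least
    \<open>\<alpha>\<close>. Solving for \<open>b\<close> and passing to the infimum over
    \<open>b\<close> replaces an explicit iteration.\<close>
  have "(\<alpha> + real DIM('a) + 1 - k) / p \<le> b" if "b \<in> A" for b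
  proof -
    have "p * b + k - 1 - real DIM('a) \<in> A" using trace_rate_iterate[of b] that by (simp add: A_def)
    then have "\<alpha> \<le> p * b + k - 1 - real DIM('a)" unfolding \<alpha>_def by (rule cInf_lower[OF _ bdd])
    then show ?thesis using p_pos by (simp add: field_simps)
  qed
  then have "(\<alpha> + real DIM('a) + 1 - k) / p \<le> \<alpha>" unfolding \<alpha>_def
    by (intro cInf_greatest) (use k1 in auto)
  then have "\<alpha> + real DIM('a) + 1 - k \<le> p * \<alpha>" using p_pos by (simp add: field_simps)
  then have ge: "real DIM('a) + 1 - k \<le> (p - 1) * \<alpha>" by (simp add: algebra_simps)
  \<comment> \<open>The left side of \<open>ge\<close> is positive because k < d, while p <= 1 would
    make the right side nonpositive. With p > 1, \<open>\<alpha>\<close> may be replaced by its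
    upper bound k - 1.\<close>
  have "p > 1"
  proof (rule ccontr)
    assume "\<not> p > 1"
    then have "(p - 1) * \<alpha> \<le> 0" using \<open>\<alpha> > 0\<close> by (simp add: mult_nonpos_nonneg)
    with ge k_lt show False by simp
  qed
  then have "(p - 1) * \<alpha> \<le> (p - 1) * (k - 1)" using ub by (intro mult_left_mono) auto
  with ge show ?thesis by (simp add: algebra_simps)
qed

lemma trace_not_in_Lp_critical:
  assumes a: "trace_rate u a" and crit: "p * (k - 1) = real DIM('a)"
  shows "\<not> trace_in_Lp u p"
proof
  assume "trace_in_Lp u p"
  then have fin: "(\<integral>\<^sup>+ x'. ennreal (\<bar>u (x', 0)\<bar> powr p) \<partial>lborel) < \<infinity>"
    by (simp add: trace_in_Lp_def nn_integral_completion)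
  obtain c where c: "c > 0" "AE x' in lborel. c * (1 + norm x') powr - (p * (k - 1)) \<le> u (x', 0) powr p"
    using trace_rate_powr[OF trace_rate_k_minus_1[OF a] p_pos] .
  have "(\<integral>\<^sup>+ x'. ennreal (c * (1 + norm (x'::'a)) powr - real DIM('a)) \<partial>lborel) = \<infinity>"
  proof (rule nn_integral_powr_DIM_infinite)
    show "c * 2 powr - real DIM('a) > 0" using c(1) by simp
    fix y :: 'a assume y: "1 \<le> norm y"
    have "2 powr - real DIM('a) * norm y powr - real DIM('a) = (2 * norm y) powr - real DIM('a)" by (simp add: powr_mult)
    also have "\<dots> \<le> (1 + norm y) powr - real DIM('a)" by (rule powr_mono2') (use y in auto)
    finally show "ennreal (c * 2 powr - real DIM('a) * norm y powr - real DIM('a)) \<le> ennreal (c * (1 + norm y) powr - real DIM('a))"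
      using c(1) by (intro ennreal_leI) (simp add: mult.assoc)
  qed
  moreover have "(\<integral>\<^sup>+ x'. ennreal (c * (1 + norm (x'::'a)) powr - real DIM('a)) \<partial>lborel)
     \<le> (\<integral>\<^sup>+ x'. ennreal (\<bar>u (x', 0)\<bar> powr p) \<partial>lborel)"
  proof (rule nn_integral_mono_AE)
    obtain b where b: "b > 0" "AE x' in lborel. b * (1 + norm x') powr - (k - 1) \<le> u (x', 0)"
      using trace_rate_k_minus_1[OF a] by (auto simp: trace_rate_def)
    show "AE x' in lborel. ennreal (c * (1 + norm x') powr - real DIM('a)) \<le> ennreal (\<bar>u (x', 0)\<bar> powr p)"
      using c(2) b(2)
    proof eventually_elim
      fix x' :: 'a
      assume *: "c * (1 + norm x') powr - (p * (k - 1)) \<le> u (x', 0) powr p"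
        and "b * (1 + norm x') powr - (k - 1) \<le> u (x', 0)"
      then have "0 \<le> u (x', 0)" using b(1) by (intro order_trans[OF _ \<open>b * _ \<le> _\<close>]) auto
      with * show "ennreal (c * (1 + norm x') powr - real DIM('a)) \<le> ennreal (\<bar>u (x', 0)\<bar> powr p)"
        by (intro ennreal_leI) (simp add: crit)
    qed
  qed
  ultimately show False using fin by (simp add: top_unique)
qed

end

subsection \<open>Existence\<close>

text \<open>If a < b, write b = a (1 + t) and divide by a^(-s); it remains to see 1 <= (1 + t)^(-s)
  + (1 + s) t^\<gamma>. For t >= 1 the last term is at least 1; for t < 1, (1 + t)^(-s) >= 1 - s t
  and t <= t^\<gamma>. The one-sided form can be integrated in \<open>ennreal\<close>, without
  subtraction.\<close>

lemma powr_minus_le_hoelder: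
  fixes a b s \<gamma> :: real
  assumes a: "a > 0" and b: "b > 0" and s: "s > 0" and \<gamma>: "0 < \<gamma>" "\<gamma> \<le> 1"
  shows "a powr - s \<le> b powr - s + (1 + s) * \<bar>a - b\<bar> powr \<gamma> * (a powr - (s + \<gamma>) + b powr - (s + \<gamma>))"
proof -
  have rhs0: "0 \<le> (1 + s) * \<bar>a - b\<bar> powr \<gamma> * b powr - (s + \<gamma>)" using s by simp
  have "a powr - s \<le> b powr - s + (1 + s) * \<bar>a - b\<bar> powr \<gamma> * a powr - (s + \<gamma>)"
  proof (cases "a \<ge> b")
    case True
    then have "a powr - s \<le> b powr - s" using b s by (intro powr_mono2') auto
    then show ?thesis using s by (simp add: add_increasing2)
  next
    case False
    define t where "t = (b - a) / a"
    have t: "t > 0" using False a by (simp add: t_def)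
    have bt: "b = a * (1 + t)" using a by (simp add: t_def field_simps)
    have tp: "\<bar>a - b\<bar> powr \<gamma> * a powr - (s + \<gamma>) = t powr \<gamma> * a powr - s"
    proof -
      have "\<bar>a - b\<bar> = a * t" using bt a t by (simp add: algebra_simps)
      then have "\<bar>a - b\<bar> powr \<gamma> * a powr - (s + \<gamma>) = t powr \<gamma> * (a powr \<gamma> * a powr - (s + \<gamma>))"
        using a t by (simp add: powr_mult mult_ac)
      also have "a powr \<gamma> * a powr - (s + \<gamma>) = a powr - s"
        unfolding powr_add[symmetric] by simp
      finally show ?thesis .
    qed
    have "1 \<le> (1 + t) powr - s + (1 + s) * t powr \<gamma>"
    proof (cases "t \<ge> 1")
      case True
      then have "1 \<le> t powr \<gamma>" using \<gamma> by (simp add: ge_one_powr_ge_zero)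
      also have "\<dots> \<le> (1 + s) * t powr \<gamma>" using s by (simp add: algebra_simps)
      finally show ?thesis by (simp add: add_increasing)
    next
      case F: False
      have "t powr 1 \<le> t powr \<gamma>" using t F \<gamma> by (intro powr_mono') auto
      then have tg: "t \<le> t powr \<gamma>" using t by simp
      have "1 - s * t \<le> 1 - s * ln (1 + t)" using s t by (simp add: ln_add_one_self_le_self)
      also have "\<dots> \<le> exp (- s * ln (1 + t))" using exp_ge_add_one_self[of "- s * ln (1 + t)"] by simp
      also have "\<dots> = (1 + t) powr - s" using t by (simp add: powr_def)
      finally have "1 \<le> (1 + t) powr - s + s * t" by simp
      also have "s * t \<le> (1 + s) * t powr \<gamma>"
        using tg s t by (intro mult_mono) auto
      finally show ?thesis by simp
    qed
    then have "a powr - s * 1 \<le> a powr - s * ((1 + t) powr - s + (1 + s) * t powr \<gamma>)"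
      by (rule mult_left_mono) simp
    also have "\<dots> = b powr - s + (1 + s) * (\<bar>a - b\<bar> powr \<gamma> * a powr - (s + \<gamma>))"
    proof -
      have "b powr - s = a powr - s * (1 + t) powr - s" unfolding bt using a t by (intro powr_mult)
      then show ?thesis unfolding tp by (simp add: algebra_simps)
    qed
    finally show ?thesis by (simp add: mult.assoc)
  qed
  with rhs0 show ?thesis unfolding distrib_left by linarith
qed

text \<open>Moving off the boundary only increases the distance. The point below x is excluded
  because \<open>0 powr - s = 0\<close>, so the right side would vanish.\<close>

lemma half_space_kernel_le:
  assumes "y \<noteq> fst x" "s \<ge> 0"
  shows "norm (x - (y, 0)) powr - s \<le> norm (fst x - y) powr - s"
proof (rule powr_mono2')
  show "norm (fst x - y) \<le> norm (x - (y, 0))" using norm_fst_le[of "fst x - y" "snd x"]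
    by (simp add: norm_Pair real_le_rsqrt minus_prod_def)
qed (use assms in auto)

lemma half_space_convolution_bound:
  assumes "0 < s" "s < real DIM('a::euclidean_space)" "0 < k" "k < real DIM('a)" "real DIM('a) < s + k"
  shows "\<exists>C>0. \<forall>x::'a \<times> real. (\<integral>\<^sup>+y. ennreal ((1 + norm y) powr - k * norm (x - (y, 0)) powr - s) \<partial>lborel)
    \<le> ennreal (C * (1 + norm (fst x)) powr (real DIM('a) - s - k))"
proof -
  obtain C where C: "C > 0" "\<And>x::'a. (\<integral>\<^sup>+y. ennreal ((1 + norm y) powr - k * norm (x - y) powr - s) \<partial>lborel)
    \<le> ennreal (C * (1 + norm x) powr (real DIM('a) - s - k))"
    using convolution_weight_bound[OF assms] by blast
  have "(\<integral>\<^sup>+y. ennreal ((1 + norm y) powr - k * norm (x - (y, 0)) powr - s) \<partial>lborel)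
    \<le> ennreal (C * (1 + norm (fst x)) powr (real DIM('a) - s - k))" for x :: "'a \<times> real"
  proof -
    have "(\<integral>\<^sup>+y. ennreal ((1 + norm y) powr - k * norm (x - (y, 0)) powr - s) \<partial>lborel)
      \<le> (\<integral>\<^sup>+y. ennreal ((1 + norm y) powr - k * norm (fst x - y) powr - s) \<partial>lborel)"
      using AE_lborel_singleton[of "fst x"] assms(1)
      by (intro nn_integral_mono_AE) (auto elim!: eventually_mono intro!: ennreal_leI mult_left_mono half_space_kernel_le)
    also note C(2)
    finally show ?thesis .
  qed
  with C(1) show ?thesis by blast
qed

section \<open>The boundary potentials: monotonicity, decay and Hoelder continuity\<close>

text \<open>This is \<open>H_u\<close> expressed through the trace \<open>v\<close>, integrated
  against \<open>lborel\<close>.\<close>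

definition riesz_pot :: "real \<Rightarrow> real \<Rightarrow> ('a::euclidean_space \<Rightarrow> real) \<Rightarrow> 'a \<Rightarrow> ennreal" where
  "riesz_pot p k v y = (\<integral>\<^sup>+z. ennreal (v z powr p / norm (y - z) powr k) \<partial>lborel)"

text \<open>The outer kernel stays inside the inner integral so that the expression matches the one
  in \<open>pos_sol\<close>.\<close>

definition double_pot :: "real \<Rightarrow> real \<Rightarrow> ('a::euclidean_space \<Rightarrow> real) \<Rightarrow> 'a \<times> real \<Rightarrow> ennreal" where
  "double_pot p k v x = (\<integral>\<^sup>+y. \<integral>\<^sup>+z. ennreal (v z powr p /
      (norm (x - (y, 0)) powr (real DIM('a) - 1) * norm (y - z) powr k)) \<partial>lborel \<partial>lborel)"

lemma borel_measurable_riesz_pot [measurable]: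
  assumes [measurable]: "v \<in> borel_measurable borel"
  shows "riesz_pot p k v \<in> borel_measurable borel"
  unfolding riesz_pot_def by measurable

lemma borel_measurable_double_pot [measurable]:
  assumes [measurable]: "v \<in> borel_measurable borel"
  shows "double_pot p k v \<in> borel_measurable borel"
  unfolding double_pot_def by measurable

lemma double_pot_eq:
  fixes v :: "'a::euclidean_space \<Rightarrow> real"
  assumes [measurable]: "v \<in> borel_measurable borel"
  shows "double_pot p k v x
    = (\<integral>\<^sup>+y. ennreal (norm (x - (y, 0)) powr - (real DIM('a) - 1)) * riesz_pot p k v y \<partial>lborel)"
proof -
  have "(\<integral>\<^sup>+z. ennreal (v z powr p / (norm (x - (y, 0)) powr (real DIM('a) - 1) * norm (y - z) powr k)) \<partial>lborel)
    = ennreal (norm (x - (y, 0)) powr - (real DIM('a) - 1)) * riesz_pot p k v y" for y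
  proof -
    have "ennreal (norm (x - (y, 0)) powr - (real DIM('a) - 1)) * riesz_pot p k v y
      = (\<integral>\<^sup>+z. ennreal (norm (x - (y, 0)) powr - (real DIM('a) - 1)) * ennreal (v z powr p / norm (y - z) powr k) \<partial>lborel)"
      unfolding riesz_pot_def by (rule nn_integral_cmult[symmetric]) measurable
    also have "\<dots> = (\<integral>\<^sup>+z. ennreal (v z powr p / (norm (x - (y, 0)) powr (real DIM('a) - 1) * norm (y - z) powr k)) \<partial>lborel)"
      unfolding powr_minus by (simp add: ennreal_mult[symmetric] divide_simps)
    finally show ?thesis by simp
  qed
  then show ?thesis unfolding double_pot_def by simp
qed

lemma double_pot_mono:
  assumes "\<And>z. 0 \<le> v z" "\<And>z. v z \<le> v' z" "p > 0"
  shows "double_pot p k v x \<le> double_pot p k v' x"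
  unfolding double_pot_def using assms
  by (intro nn_integral_mono ennreal_leI divide_right_mono powr_mono2) auto

text \<open>Monotone convergence is applied to the inner integral and then to the outer one.\<close>

lemma double_pot_LIMSEQ:
  assumes mono: "\<And>n z. v n z \<le> v (Suc n) z" and nn: "\<And>n z. 0 \<le> v n z" and p: "p > 0"
    and [measurable]: "\<And>n. v n \<in> borel_measurable borel"
    and lim: "\<And>z. (\<lambda>n. v n z) \<longlonglongrightarrow> w z"
  shows "(\<lambda>n. double_pot p k (v n) x) \<longlonglongrightarrow> double_pot p k w x"
proof -
  have inc: "incseq (\<lambda>n z. ennreal (v n z powr p / (A * norm (y - z) powr k)))" if "A \<ge> 0" for A y
    using that mono nn p
    by (intro incseq_SucI le_funI ennreal_leI divide_right_mono powr_mono2) auto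
  have inner: "(\<lambda>n. \<integral>\<^sup>+z. ennreal (v n z powr p / (A * norm (y - z) powr k)) \<partial>lborel)
     \<longlonglongrightarrow> (\<integral>\<^sup>+z. ennreal (w z powr p / (A * norm (y - z) powr k)) \<partial>lborel)" if "A \<ge> 0" for A y
  proof (rule nn_integral_LIMSEQ[OF inc[OF that]])
    fix z
    \<comment> \<open>The limit may be 0, where continuity of the power requires p > 0 and
      nonnegative terms.\<close>
    have "(\<lambda>n. v n z powr p) \<longlonglongrightarrow> w z powr p"
      by (rule tendsto_powr'[OF lim]) (use p nn in auto)
    then show "(\<lambda>n. ennreal (v n z powr p / (A * norm (y - z) powr k))) \<longlonglongrightarrow> ennreal (w z powr p / (A * norm (y - z) powr k))"
      unfolding divide_inverse by (intro tendsto_ennrealI tendsto_mult_right)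
  qed measurable
  show ?thesis unfolding double_pot_def
  proof (rule nn_integral_LIMSEQ)
    show "incseq (\<lambda>n y. \<integral>\<^sup>+z. ennreal (v n z powr p / (norm (x - (y, 0)) powr (real DIM('a) - 1) * norm (y - z) powr k)) \<partial>lborel)"
    proof (intro incseq_SucI le_funI nn_integral_mono)
      fix n y z
      show "ennreal (v n z powr p / (norm (x - (y, 0)) powr (real DIM('a) - 1) * norm (y - z) powr k))
        \<le> ennreal (v (Suc n) z powr p / (norm (x - (y, 0)) powr (real DIM('a) - 1) * norm (y - z) powr k))"
        using mono nn p by (intro ennreal_leI divide_right_mono powr_mono2) auto
    qed
    show "(\<lambda>y. \<integral>\<^sup>+z. ennreal (v n z powr p / (norm (x - (y, 0)) powr (real DIM('a) - 1) * norm (y - z) powr k)) \<partial>lborel)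
      \<in> borel_measurable lborel" for n by measurable
  qed (rule inner, simp)
qed

text \<open>This is where p (k - 1) > d enters: it makes the bound on v^p integrable. The dependence
  A^p is kept explicit because the smallness of lambda is measured against it.\<close>

lemma riesz_pot_bound:
  assumes k: "1 < k" "k < real DIM('a::euclidean_space)" and p: "real DIM('a) < p * (k - 1)" "p > 0"
  shows "\<exists>C>0. \<forall>A>0. \<forall>v::'a \<Rightarrow> real. (\<forall>z. 0 \<le> v z \<and> v z \<le> A * (1 + norm z) powr (1 - k)) \<longrightarrow>
     (\<forall>y. riesz_pot p k v y \<le> ennreal (C * A powr p * (1 + norm y) powr - k))"
proof -
  obtain C where C: "C > 0" "\<And>x::'a. (\<integral>\<^sup>+y. ennreal ((1 + norm y) powr - (p * (k - 1)) * norm (x - y) powr - k) \<partial>lborel)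
    \<le> ennreal (C * (1 + norm x) powr - k)"
    using convolution_integrable_weight_bound[of k "p * (k - 1)"] k p by (auto)
  have "riesz_pot p k v y \<le> ennreal (C * A powr p * (1 + norm y) powr - k)"
    if A: "A > 0" and v: "\<And>z. 0 \<le> v z \<and> v z \<le> A * (1 + norm z) powr (1 - k)" for A and v :: "'a \<Rightarrow> real" and y
  proof -
    have "riesz_pot p k v y \<le> (\<integral>\<^sup>+z. ennreal (A powr p) * ennreal ((1 + norm z) powr - (p * (k - 1)) * norm (y - z) powr - k) \<partial>lborel)"
      unfolding riesz_pot_def
    proof (rule nn_integral_mono)
      fix z
      have "v z powr p \<le> (A * (1 + norm z) powr (1 - k)) powr p" using v p by (intro powr_mono2) auto
      also have "\<dots> = A powr p * (1 + norm z) powr - (p * (k - 1))"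
        using A by (simp add: powr_mult powr_powr algebra_simps)
      finally have "v z powr p * norm (y - z) powr - k \<le> A powr p * (1 + norm z) powr - (p * (k - 1)) * norm (y - z) powr - k"
        by (rule mult_right_mono) simp
      then show "ennreal (v z powr p / norm (y - z) powr k) \<le> ennreal (A powr p) * ennreal ((1 + norm z) powr - (p * (k - 1)) * norm (y - z) powr - k)"
        by (simp add: ennreal_mult[symmetric] powr_minus divide_inverse mult.assoc ennreal_leI)
    qed
    also have "\<dots> = ennreal (A powr p) * (\<integral>\<^sup>+z. ennreal ((1 + norm z) powr - (p * (k - 1)) * norm (y - z) powr - k) \<partial>lborel)"
      by (rule nn_integral_cmult) measurable
    also have "\<dots> \<le> ennreal (A powr p) * ennreal (C * (1 + norm y) powr - k)"
      by (intro mult_left_mono C(2)) auto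
    also have "\<dots> = ennreal (C * A powr p * (1 + norm y) powr - k)"
      using C(1) by (simp add: ennreal_mult[symmetric] mult_ac)
    finally show ?thesis .
  qed
  with C(1) show ?thesis by blast
qed

text \<open>A density of order (1 + |y|)^(-k) is convolved with the kernel of exponent d - 1; their
  sum exceeds d because k > 1, and d - (d - 1) - k = 1 - k. The height of x does not enter the
  bound.\<close>

lemma double_pot_bound:
  assumes d: "DIM('a::euclidean_space) \<ge> 2" and k: "1 < k" "k < real DIM('a)"
    and p: "real DIM('a) < p * (k - 1)" "p > 0"
  shows "\<exists>C>0. \<forall>A>0. \<forall>v\<in>borel_measurable borel. (\<forall>z::'a. 0 \<le> v z \<and> v z \<le> A * (1 + norm z) powr (1 - k)) \<longrightarrow>
     (\<forall>x. double_pot p k v x \<le> ennreal (C * A powr p * (1 + norm (fst x)) powr (1 - k)))"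
proof -
  obtain C1 where C1: "C1 > 0" "\<And>A (v::'a \<Rightarrow> real) y. A > 0 \<Longrightarrow> (\<And>z. 0 \<le> v z \<and> v z \<le> A * (1 + norm z) powr (1 - k)) \<Longrightarrow>
     riesz_pot p k v y \<le> ennreal (C1 * A powr p * (1 + norm y) powr - k)"
    using riesz_pot_bound[OF k p] by blast
  obtain C2 where C2: "C2 > 0" "\<And>x::'a \<times> real. (\<integral>\<^sup>+y. ennreal ((1 + norm y) powr - k * norm (x - (y, 0)) powr - (real DIM('a) - 1)) \<partial>lborel)
    \<le> ennreal (C2 * (1 + norm (fst x)) powr (real DIM('a) - (real DIM('a) - 1) - k))"
    using half_space_convolution_bound[where 'a='a, of "real DIM('a) - 1" k] d k by fastforce
  have "double_pot p k v x \<le> ennreal (C1 * C2 * A powr p * (1 + norm (fst x)) powr (1 - k))"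
    if A: "A > 0" and [measurable]: "v \<in> borel_measurable borel"
      and v: "\<And>z::'a. 0 \<le> v z \<and> v z \<le> A * (1 + norm z) powr (1 - k)" for A v x
  proof -
    have "double_pot p k v x \<le> (\<integral>\<^sup>+y. ennreal (C1 * A powr p) * ennreal ((1 + norm y) powr - k * norm (x - (y, 0)) powr - (real DIM('a) - 1)) \<partial>lborel)"
      unfolding double_pot_eq[OF that(2)]
    proof (rule nn_integral_mono)
      fix y
      have "ennreal (norm (x - (y, 0)) powr - (real DIM('a) - 1)) * riesz_pot p k v y
         \<le> ennreal (norm (x - (y, 0)) powr - (real DIM('a) - 1)) * ennreal (C1 * A powr p * (1 + norm y) powr - k)"
        by (intro mult_left_mono C1(2) A v) auto
      then show "ennreal (norm (x - (y, 0)) powr - (real DIM('a) - 1)) * riesz_pot p k v y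
        \<le> ennreal (C1 * A powr p) * ennreal ((1 + norm y) powr - k * norm (x - (y, 0)) powr - (real DIM('a) - 1))"
        using C1(1) by (simp add: ennreal_mult[symmetric] mult_ac)
    qed
    also have "\<dots> = ennreal (C1 * A powr p) * (\<integral>\<^sup>+y. ennreal ((1 + norm y) powr - k * norm (x - (y, 0)) powr - (real DIM('a) - 1)) \<partial>lborel)"
      by (rule nn_integral_cmult) measurable
    also have "\<dots> \<le> ennreal (C1 * A powr p) * ennreal (C2 * (1 + norm (fst x)) powr (real DIM('a) - (real DIM('a) - 1) - k))"
      by (intro mult_left_mono C2(2)) auto
    also have "\<dots> = ennreal (C1 * C2 * A powr p * (1 + norm (fst x)) powr (1 - k))"
      using C1(1) C2(1) by (simp add: ennreal_mult[symmetric] mult_ac)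
    finally show ?thesis .
  qed
  moreover have "C1 * C2 > 0" using C1(1) C2(1) by simp
  ultimately show ?thesis by blast
qed

lemma double_pot_hoelder:
  assumes d: "DIM('a::euclidean_space) \<ge> 2" and k: "1 < k" "k < real DIM('a)"
    and v[measurable]: "(v :: 'a \<Rightarrow> real) \<in> borel_measurable borel"
    and D: "D \<ge> 0" and h: "\<And>y. riesz_pot p k v y \<le> ennreal (D * (1 + norm y) powr - k)"
  shows "\<exists>M\<ge>0. \<forall>x x'. double_pot p k v x \<le> double_pot p k v x' + ennreal (M * dist x x' powr (1/2))"
proof -
  let ?s = "real DIM('a) - 1" and ?t = "real DIM('a) - 1 + 1/2"
  obtain C where C: "C > 0" "\<And>x::'a \<times> real. (\<integral>\<^sup>+y. ennreal ((1 + norm y) powr - k * norm (x - (y, 0)) powr - ?t) \<partial>lborel)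
    \<le> ennreal (C * (1 + norm (fst x)) powr (real DIM('a) - ?t - k))"
    using half_space_convolution_bound[where 'a='a, of ?t k] d k by fastforce
  have C': "(\<integral>\<^sup>+y. ennreal ((1 + norm y) powr - k * norm (x - (y, 0)) powr - ?t) \<partial>lborel) \<le> ennreal C" for x :: "'a \<times> real"
  proof -
    \<comment> \<open>Here d - \<open>?t\<close> - k = 1/2 - k is negative, so the bound becomes
      uniform in \<open>x\<close>.\<close>
    have "(1 + norm (fst x)) powr (real DIM('a) - ?t - k) \<le> (1 + norm (fst x)) powr 0"
      by (rule powr_mono) (use k in auto)
    also have "(1 + norm (fst x)) powr 0 = 1" by (simp add: add_nonneg_eq_0_iff)
    finally have "ennreal (C * (1 + norm (fst x)) powr (real DIM('a) - ?t - k)) \<le> ennreal C"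
      using C(1) by (intro ennreal_leI) simp
    with C(2)[of x] show ?thesis by (rule order_trans)
  qed
  \<comment> \<open>The factor d is 1 + s from \<open>powr_minus_le_hoelder\<close>,
    \<open>D\<close> bounds the density, and \<open>C + C\<close> accounts for the kernels at
    \<open>x\<close> and \<open>x'\<close>.\<close>
  define M where "M = real DIM('a) * D * (C + C)"
  have "double_pot p k v x \<le> double_pot p k v x' + ennreal (M * dist x x' powr (1/2))" for x x'
  proof -
    define \<delta> where "\<delta> = dist x x' powr (1/2)"
    let ?a = "\<lambda>y. norm (x - (y, 0))" and ?b = "\<lambda>y. norm (x' - (y, 0))"
    have "double_pot p k v x \<le> (\<integral>\<^sup>+y. ennreal (?b y powr - ?s) * riesz_pot p k v y
       + ennreal (real DIM('a) * D * \<delta>) * (ennreal ((1 + norm y) powr - k * ?a y powr - ?t)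
           + ennreal ((1 + norm y) powr - k * ?b y powr - ?t)) \<partial>lborel)"
      unfolding double_pot_eq[OF v]
    proof (rule nn_integral_mono_AE)
      show "AE y in lborel. ennreal (?a y powr - ?s) * riesz_pot p k v y \<le> ennreal (?b y powr - ?s) * riesz_pot p k v y
       + ennreal (real DIM('a) * D * \<delta>) * (ennreal ((1 + norm y) powr - k * ?a y powr - ?t)
           + ennreal ((1 + norm y) powr - k * ?b y powr - ?t))"
        using AE_lborel_singleton[of "fst x"] AE_lborel_singleton[of "fst x'"]
      proof eventually_elim
        fix y assume y: "y \<noteq> fst x" "y \<noteq> fst x'"
        then have ab: "?a y > 0" "?b y > 0" by (auto simp: prod_eq_iff)
        define E where "E = ?a y powr - ?t + ?b y powr - ?t"
        have "\<bar>?a y - ?b y\<bar> \<le> dist x x'" using norm_triangle_ineq3[of "x - (y, 0)" "x' - (y, 0)"]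
          by (simp add: dist_norm)
        then have "\<bar>?a y - ?b y\<bar> powr (1/2) \<le> \<delta>" unfolding \<delta>_def by (intro powr_mono2) auto
        then have A: "(1 + ?s) * \<bar>?a y - ?b y\<bar> powr (1/2) * E \<le> (1 + ?s) * \<delta> * E"
          by (intro mult_right_mono mult_left_mono) (auto simp: E_def)
        have B: "?a y powr - ?s \<le> ?b y powr - ?s + (1 + ?s) * \<bar>?a y - ?b y\<bar> powr (1/2) * E"
          unfolding E_def using ab d by (intro powr_minus_le_hoelder) auto
        have "?a y powr - ?s \<le> ?b y powr - ?s + real DIM('a) * \<delta> * E"
          using order_trans[OF B add_left_mono[OF A]] by simp
        then have "ennreal (?a y powr - ?s) \<le> ennreal (?b y powr - ?s + real DIM('a) * \<delta> * E)"
          by (rule ennreal_leI)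
        also have "\<dots> = ennreal (?b y powr - ?s) + ennreal (real DIM('a) * \<delta> * E)"
          by (rule ennreal_plus) (auto simp: E_def \<delta>_def)
        finally have "ennreal (?a y powr - ?s) * riesz_pot p k v y
           \<le> (ennreal (?b y powr - ?s) + ennreal (real DIM('a) * \<delta> * E)) * riesz_pot p k v y"
          by (rule mult_right_mono) simp
        also have "\<dots> = ennreal (?b y powr - ?s) * riesz_pot p k v y + ennreal (real DIM('a) * \<delta> * E) * riesz_pot p k v y"
          by (rule distrib_right)
        also have "\<dots> \<le> ennreal (?b y powr - ?s) * riesz_pot p k v y + ennreal (real DIM('a) * \<delta> * E) * ennreal (D * (1 + norm y) powr - k)"
          by (intro add_left_mono mult_left_mono h) auto
        also have "ennreal (real DIM('a) * \<delta> * E) * ennreal (D * (1 + norm y) powr - k)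
          = ennreal (real DIM('a) * D * \<delta>) * (ennreal ((1 + norm y) powr - k * ?a y powr - ?t)
           + ennreal ((1 + norm y) powr - k * ?b y powr - ?t))"
        proof -
          have "real DIM('a) * \<delta> * E * (D * (1 + norm y) powr - k) = real DIM('a) * D * \<delta> * ((1 + norm y) powr - k * ?a y powr - ?t
             + (1 + norm y) powr - k * ?b y powr - ?t)" by (simp add: E_def algebra_simps)
          moreover have "E \<ge> 0" "\<delta> \<ge> 0" by (auto simp: E_def \<delta>_def)
          ultimately show ?thesis using D 
            by (simp add: ennreal_mult[symmetric] ennreal_plus[symmetric] del: ennreal_plus)
        qed
        finally show "ennreal (?a y powr - ?s) * riesz_pot p k v y \<le> ennreal (?b y powr - ?s) * riesz_pot p k v y
          + ennreal (real DIM('a) * D * \<delta>) * (ennreal ((1 + norm y) powr - k * ?a y powr - ?t)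
           + ennreal ((1 + norm y) powr - k * ?b y powr - ?t))" .
      qed
    qed
    also have "\<dots> = double_pot p k v x' + ennreal (real DIM('a) * D * \<delta>) * ((\<integral>\<^sup>+y. ennreal ((1 + norm y) powr - k * ?a y powr - ?t) \<partial>lborel)
           + (\<integral>\<^sup>+y. ennreal ((1 + norm y) powr - k * ?b y powr - ?t) \<partial>lborel))"
      unfolding double_pot_eq[OF v] by (subst nn_integral_add, measurable, subst nn_integral_cmult, measurable, subst nn_integral_add, auto)
    also have "\<dots> \<le> double_pot p k v x' + ennreal (real DIM('a) * D * \<delta>) * (ennreal C + ennreal C)"
      by (intro add_left_mono mult_left_mono add_mono C') auto
    also have "ennreal (real DIM('a) * D * \<delta>) * (ennreal C + ennreal C) = ennreal (M * \<delta>)"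
      using C(1) D by (simp add: M_def \<delta>_def ennreal_mult[symmetric] ennreal_plus[symmetric] mult_ac del: ennreal_plus)
    finally show ?thesis by (simp add: \<delta>_def)
  qed
  moreover have "M \<ge> 0" using C(1) D by (simp add: M_def)
  ultimately show ?thesis by blast
qed

section \<open>Measurability and boundary continuity of the Newtonian potential\<close>

lemma borel_measurable_PhiE [measurable]: "PhiE \<in> borel_measurable (borel :: 'b::euclidean_space measure)"
  unfolding PhiE_def by measurable

lemma radon_measure_sigma_finite:
  assumes "radon_measure \<mu>" shows "sigma_finite_measure \<mu>"
proof (unfold_locales, intro exI conjI)
  let ?A = "range (\<lambda>n::nat. cball (0::'a) (real n))"
  have sets: "sets \<mu> = sets borel" using assms by (simp add: radon_measure_def)
  show "countable ?A" by simp
  show "?A \<subseteq> sets \<mu>" by (auto simp: sets)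
  show "\<Union> ?A = space \<mu>" using sets_eq_imp_space_eq[OF sets] by (auto simp: real_arch_simple)
  show "\<forall>a\<in>?A. emeasure \<mu> a \<noteq> \<infinity>" using assms by (auto simp: radon_measure_def less_top[symmetric])
qed

lemma borel_measurable_newton_pot:
  assumes "radon_measure \<mu>" shows "newton_pot \<mu> \<in> borel_measurable borel"
proof -
  interpret sigma_finite_measure \<mu> by (rule radon_measure_sigma_finite[OF assms])
  have [measurable_cong]: "sets \<mu> = sets borel" using assms by (simp add: radon_measure_def)
  show ?thesis unfolding newton_pot_def[abs_def] by measurable
qed

lemma nn_integral_greenN:
  assumes "radon_measure \<mu>"
  shows "(\<integral>\<^sup>+ y. greenN x y \<partial>\<mu>) = newton_pot \<mu> x + newton_pot \<mu> (reflect x)"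
proof -
  have [measurable_cong]: "sets \<mu> = sets borel" using assms by (simp add: radon_measure_def)
  show ?thesis unfolding greenN_def newton_pot_def by (rule nn_integral_add) measurable
qed

lemma continuous_reflect: "continuous_on UNIV (reflect :: 'a::euclidean_space \<times> real \<Rightarrow> _)"
  unfolding reflect_def[abs_def] by (intro continuous_intros)

lemma PhiE_le_of_half:
  fixes z w :: "'b::euclidean_space"
  assumes "DIM('b) \<ge> 3" "z \<noteq> 0" "norm z / 2 \<le> norm w"
  shows "PhiE w \<le> ennreal (2 powr (real DIM('b) - 2)) * PhiE z"
proof -
  have "norm z > 0" using assms by simp
  then have w: "norm w > 0" using assms(3) by linarith
  have "norm w powr (2 - real DIM('b)) \<le> (norm z / 2) powr (2 - real DIM('b))"
    by (rule powr_mono2') (use assms in auto)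
  also have "\<dots> = 2 powr (real DIM('b) - 2) * norm z powr (2 - real DIM('b))"
    using assms by (simp add: powr_divide powr_diff)
  finally show ?thesis
    using assms w sigmaN_pos[where 'b='b]
    by (auto simp: PhiE_def ennreal_mult[symmetric] divide_simps intro!: ennreal_leI)
qed

lemma isCont_PhiE:
  assumes "z \<noteq> 0" shows "isCont PhiE z"
proof -
  have "isCont (\<lambda>z::'a. ennreal (1 / ((real DIM('a) - 2) * sigmaN TYPE('a)) * norm z powr (2 - real DIM('a)))) z"
    using assms unfolding isCont_def by (intro tendsto_ennrealI tendsto_intros) auto
  moreover have "\<forall>\<^sub>F w in nhds z. w \<noteq> 0" using assms by (rule t1_space_nhds)
  then have "\<forall>\<^sub>F w in nhds z. PhiE w = ennreal (1 / ((real DIM('a) - 2) * sigmaN TYPE('a)) * norm w powr (2 - real DIM('a)))"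
    by eventually_elim (simp add: PhiE_def)
  ultimately show ?thesis by (subst isCont_cong)
qed

text \<open>Almost every y keeps a distance e from x0, so for x within e/2 of x0 one has |x0-y|/2 <=
  |x-y|. A multiple of the kernel at x0 is then a majorant, integrable because the potential is
  finite at x0, and dominated convergence applies.\<close>

lemma isCont_newton_pot_outside_support:
  fixes \<mu> :: "'b::euclidean_space measure"
  assumes N: "DIM('b) \<ge> 3" and radon: "radon_measure \<mu>" and x0: "x0 \<notin> measure_support \<mu>"
    and fin: "newton_pot \<mu> x0 < \<infinity>"
  shows "isCont (newton_pot \<mu>) x0"
proof -
  have sets[measurable_cong, simp]: "sets \<mu> = sets borel" using radon by (simp add: radon_measure_def)
  obtain e where e: "e > 0" "emeasure \<mu> (ball x0 e) = 0"
    using x0 by (auto simp: measure_support_def)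
  then have ae: "AE y in \<mu>. y \<notin> ball x0 e" by (intro AE_not_in null_setsI) auto
  show ?thesis unfolding isCont_def tendsto_at_iff_sequentially
  proof (intro allI impI)
    fix X assume "X \<longlonglongrightarrow> x0"
    then obtain n0 where n0: "\<And>n. n \<ge> n0 \<Longrightarrow> dist (X n) x0 < e / 2"
      using e(1) by (meson half_gt_zero lim_sequentially)
    define Y where "Y n = X (n + n0)" for n
    have Y: "Y \<longlonglongrightarrow> x0" "\<And>n. dist (Y n) x0 < e / 2"
      using LIMSEQ_ignore_initial_segment[OF \<open>X \<longlonglongrightarrow> x0\<close>, of n0] n0 unfolding Y_def[abs_def] by auto
    have "(\<lambda>n. newton_pot \<mu> (Y n)) \<longlonglongrightarrow> newton_pot \<mu> x0"
      unfolding newton_pot_def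
    proof (rule nn_integral_dominated_convergence[where w="\<lambda>y. ennreal (2 powr (real DIM('b) - 2)) * PhiE (x0 - y)"])
      show "AE y in \<mu>. PhiE (Y n - y) \<le> ennreal (2 powr (real DIM('b) - 2)) * PhiE (x0 - y)" for n
        using ae
      proof eventually_elim
        fix y assume y: "y \<notin> ball x0 e"
        then have "e \<le> norm (x0 - y)" by (simp add: dist_norm)
        moreover have "norm (x0 - y) \<le> norm (Y n - y) + norm (Y n - x0)"
          using norm_triangle_ineq4[of "Y n - y" "Y n - x0"] by simp
        moreover have "norm (Y n - x0) < e / 2" using Y(2)[of n] by (simp add: dist_norm)
        ultimately have "norm (x0 - y) / 2 \<le> norm (Y n - y)" by linarith
        moreover have "x0 - y \<noteq> 0" using y e(1) by auto
        ultimately show "PhiE (Y n - y) \<le> ennreal (2 powr (real DIM('b) - 2)) * PhiE (x0 - y)"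
          using N by (intro PhiE_le_of_half)
      qed
      have "(\<integral>\<^sup>+ y. ennreal (2 powr (real DIM('b) - 2)) * PhiE (x0 - y) \<partial>\<mu>)
         = ennreal (2 powr (real DIM('b) - 2)) * newton_pot \<mu> x0"
        unfolding newton_pot_def by (rule nn_integral_cmult) measurable
      then show "(\<integral>\<^sup>+ y. ennreal (2 powr (real DIM('b) - 2)) * PhiE (x0 - y) \<partial>\<mu>) < \<infinity>"
        using fin by (simp add: ennreal_mult_less_top)
      show "AE y in \<mu>. (\<lambda>n. PhiE (Y n - y)) \<longlonglongrightarrow> PhiE (x0 - y)"
        using ae
      proof eventually_elim
        fix y assume y: "y \<notin> ball x0 e"
        then have "isCont PhiE (x0 - y)" using e(1) by (intro isCont_PhiE) auto
        moreover have "(\<lambda>n. Y n - y) \<longlonglongrightarrow> x0 - y" by (intro tendsto_intros Y)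
        ultimately show "(\<lambda>n. PhiE (Y n - y)) \<longlonglongrightarrow> PhiE (x0 - y)" by (rule isCont_tendsto_compose)
      qed
    qed measurable
    then show "(newton_pot \<mu> \<circ> X) \<longlonglongrightarrow> newton_pot \<mu> x0"
      unfolding Y_def o_def by (rule LIMSEQ_offset)
  qed
qed

section \<open>Monotone iteration for the trace and construction of the solution\<close>

lemma positive_solution_exists:
  fixes \<mu> :: "('a::euclidean_space \<times> real) measure" and k p :: real
  assumes N3: "DIM('a) \<ge> 2" and k: "1 < k" "k < real DIM('a)"
    and p: "real DIM('a) < p * (k - 1)" "p > 0"
    and radon: "radon_measure \<mu>" and nonzero: "emeasure \<mu> (space \<mu>) \<noteq> 0"
    and supp: "measure_support \<mu> \<subseteq> upper_half"
    and pot_fin: "\<forall>x. newton_pot \<mu> x < \<infinity>"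
    and C: "C > 0" "AE x in lebesgue. newton_pot \<mu> x \<le> ennreal (C * (1 + norm x) powr (1 - k))"
  shows "\<exists>lam_s>0. \<forall>lam. 0 < lam \<and> lam < lam_s \<longrightarrow>
           (\<exists>u. pos_sol \<mu> lam p k u \<and>
                 hoelder_on (1/2) closed_upper_half
                   (\<lambda>x. u x - enn2real (\<integral>\<^sup>+ y. greenN x y \<partial>\<mu>)))"
proof -
  define G where "G x = (\<integral>\<^sup>+ y. greenN x y \<partial>\<mu>)" for x
  have G_eq: "G x = newton_pot \<mu> x + newton_pot \<mu> (reflect x)" for x
    unfolding G_def by (rule nn_integral_greenN[OF radon])
  have G_fin: "G x < \<infinity>" for x unfolding G_eq using pot_fin[rule_format, of x] pot_fin[rule_format, of "reflect x"] by simp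
  have [measurable]: "reflect \<in> borel_measurable (borel :: ('a \<times> real) measure)"
    by (rule borel_measurable_continuous_onI[OF continuous_reflect])
  have [measurable]: "newton_pot \<mu> \<in> borel_measurable borel" by (rule borel_measurable_newton_pot[OF radon])
  have G_meas[measurable]: "G \<in> borel_measurable borel" unfolding G_eq[abs_def] by measurable
  have embed[measurable]: "(\<lambda>x'::'a. (x', 0::real)) \<in> borel \<rightarrow>\<^sub>M borel"
    by (intro borel_measurable_continuous_onI continuous_intros)
  have cont_pot: "isCont (newton_pot \<mu>) (x', 0)" for x'
  proof -
    have "(x', 0) \<notin> measure_support \<mu>" using supp by (auto simp: upper_half_def)
    then show ?thesis using isCont_newton_pot_outside_support[OF _ radon] pot_fin N3 by simp
  qed
  have refl0: "reflect (x', 0) = (x', 0)" for x' :: 'a by (simp add: reflect_def)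
  have cont_G: "isCont G (x', 0)" for x'
  proof -
    have "isCont reflect (x', 0)" using continuous_reflect continuous_on_eq_continuous_at[OF open_UNIV] by blast
    then have "isCont (\<lambda>x. newton_pot \<mu> (reflect x)) (x', 0)"
      by (rule isCont_o2) (simp add: refl0 cont_pot)
    with cont_pot[of x'] show ?thesis unfolding G_eq[abs_def] isCont_def by (intro tendsto_add)
  qed
  \<comment> \<open>The decay hypothesis holds almost everywhere and may fail on the null boundary;
    continuity of the potential there extends it. The roles are reversed in
    \<open>boundary_limit_of_upper_half\<close>: its upper function is the explicit bound.\<close>
  have pot_bdry: "newton_pot \<mu> (x', 0) \<le> ennreal (C * (1 + norm x') powr (1 - k))" for x'
  proof -
    have "newton_pot \<mu> (x', 0) \<le> ennreal (C * (1 + norm (x', 0::real)) powr (1 - k))"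
    proof (rule boundary_limit_of_upper_half[where u="\<lambda>x. ennreal (C * (1 + norm x) powr (1 - k))"])
      show "AE x in lebesgue. x \<in> upper_half \<longrightarrow> newton_pot \<mu> x \<le> ennreal (C * (1 + norm x) powr (1 - k))"
        using C(2) by eventually_elim simp
      have "isCont (\<lambda>x. C * (1 + norm x) powr (1 - k)) (x', 0::real)"
        by (intro continuous_intros) (simp add: add_nonneg_eq_0_iff)
      then have "((\<lambda>x. C * (1 + norm x) powr (1 - k)) \<longlongrightarrow> C * (1 + norm (x', 0::real)) powr (1 - k)) (at (x', 0::real))"
        unfolding isCont_def .
      then show "((\<lambda>x. ennreal (C * (1 + norm x) powr (1 - k))) \<longlongrightarrow> ennreal (C * (1 + norm (x', 0::real)) powr (1 - k)))
           (at (x', 0) within upper_half)"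
        by (intro tendsto_ennrealI) (erule tendsto_within_subset, simp)
    qed (rule cont_pot)
    then show ?thesis by (simp add: norm_Pair)
  qed
  have G_bdry: "G (x', 0) \<le> ennreal (2 * C * (1 + norm x') powr (1 - k))" for x'
  proof -
    have "G (x', 0) \<le> ennreal (C * (1 + norm x') powr (1 - k)) + ennreal (C * (1 + norm x') powr (1 - k))"
      unfolding G_eq refl0 by (intro add_mono pot_bdry)
    also have "\<dots> = ennreal (2 * C * (1 + norm x') powr (1 - k))"
      using C(1) by (simp add: ennreal_plus[symmetric] del: ennreal_plus)
    finally show ?thesis .
  qed
  have G_pos: "G x > 0" for x
  proof -
    obtain c where c: "c > 0" "\<And>x. ennreal (c * (1 + norm x) powr - (real DIM('a) - 1)) \<le> G x"
      using green_potential_ge[OF N3 radon nonzero] unfolding G_def by blast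
    have "c * (1 + norm x) powr - (real DIM('a) - 1) > 0" using c(1) by (simp add: add_nonneg_eq_0_iff)
    then show ?thesis using c(2)[of x] by (metis ennreal_less_zero_iff less_le_trans)
  qed
  obtain B where B: "B > 0" "\<And>A v x. A > 0 \<Longrightarrow> v \<in> borel_measurable borel \<Longrightarrow>
     (\<And>z::'a. 0 \<le> v z \<and> v z \<le> A * (1 + norm z) powr (1 - k)) \<Longrightarrow>
     double_pot p k v x \<le> ennreal (B * A powr p * (1 + norm (fst x)) powr (1 - k))"
    using double_pot_bound[OF N3 k p] by blast
  \<comment> \<open>2 C pays for the Green part, where a boundary point equals its reflection; the
    remaining 1 is reserved for the double potential, and \<open>lam_s\<close> is chosen so that
    this share suffices.\<close>
  define A where "A = 2 * C + 1"
  have A: "A > 0" using C(1) by (simp add: A_def)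
  define \<kappa> where "\<kappa> = 2 / ((real DIM('a) - 1) * sigmaN TYPE('a \<times> real))"
  have \<kappa>: "\<kappa> > 0" using N3 sigmaN_pos[where 'b="'a \<times> real"] by (simp add: \<kappa>_def)
  define lam_s where "lam_s = 1 / (\<kappa> * B * A powr p)"
  have "\<exists>u. pos_sol \<mu> lam p k u \<and> hoelder_on (1/2) closed_upper_half (\<lambda>x. u x - enn2real (G x))"
    if lam: "0 < lam" "lam < lam_s" for lam
  proof -
    define L where "L = lam * \<kappa>"
    have L: "L > 0" using lam \<kappa> by (simp add: L_def)
    have small: "L * (B * A powr p) \<le> 1"
      using lam(2) \<kappa> B(1) A by (simp add: lam_s_def L_def field_simps)
    define T where "T v x' = enn2real (G (x', 0) + ennreal L * double_pot p k v (x', 0))" for v and x' :: 'a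
    define adm where "adm v \<longleftrightarrow> v \<in> borel_measurable borel \<and> (\<forall>z::'a. 0 \<le> v z \<and> v z \<le> A * (1 + norm z) powr (1 - k))" for v
    have adm_pot: "double_pot p k v x \<le> ennreal (B * A powr p * (1 + norm (fst x)) powr (1 - k))" if "adm v" for v x
      using that A by (intro B(2)) (auto simp: adm_def)
    have pot_finite: "double_pot p k v x < \<infinity>" if "adm v" for v x
      using adm_pot[OF that, of x] by (rule le_less_trans) simp
    \<comment> \<open>On admissible functions both terms are finite, so \<open>enn2real\<close> in
      \<open>T\<close> loses nothing.\<close>
    have T_eq: "ennreal (T v x') = G (x', 0) + ennreal L * double_pot p k v (x', 0)" if "adm v" for v x'
      unfolding T_def using G_fin[of "(x', 0)"] pot_finite[OF that, of "(x', 0)"]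
      by (intro ennreal_enn2real) (simp add: ennreal_mult_less_top)
    have T_adm: "adm (T v)" if v: "adm v" for v
      unfolding adm_def
    proof (intro conjI allI)
      have [measurable]: "v \<in> borel_measurable borel" using v by (simp add: adm_def)
      show "T v \<in> borel_measurable borel" unfolding T_def[abs_def] by measurable
      fix z :: 'a
      show "0 \<le> T v z" by (simp add: T_def)
      let ?w = "(1 + norm z) powr (1 - k)"
      have "ennreal (T v z) \<le> ennreal (2 * C * ?w) + ennreal L * ennreal (B * A powr p * ?w)"
        unfolding T_eq[OF v] using adm_pot[OF v, of "(z, 0)"] by (intro add_mono mult_left_mono G_bdry) auto
      also have "\<dots> = ennreal (2 * C * ?w + L * (B * A powr p) * ?w)"
        using C(1) L B(1) by (simp add: ennreal_mult[symmetric] ennreal_plus[symmetric] mult_ac del: ennreal_plus)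
      also have "\<dots> \<le> ennreal (A * ?w)"
      proof (rule ennreal_leI)
        have "L * (B * A powr p) * ?w \<le> 1 * ?w" by (intro mult_right_mono small) simp
        then show "2 * C * ?w + L * (B * A powr p) * ?w \<le> A * ?w" by (simp add: A_def algebra_simps)
      qed
      finally show "T v z \<le> A * ?w" using A by (simp add: ennreal_le_iff)
    qed
    \<comment> \<open>The start 0 lies below its image, so monotonicity of \<open>T\<close> makes
      the iterates increase, and admissibility bounds them.\<close>
    define vs where "vs n = (T ^^ n) (\<lambda>_. 0)" for n
    have vs_Suc: "vs (Suc n) = T (vs n)" for n by (simp add: vs_def)
    have adm0: "adm (vs n)" for n
    proof (induction n)
      case 0 show ?case using A by (simp add: vs_def adm_def)
    qed (simp add: vs_Suc T_adm)
    have T_mono: "T v x' \<le> T v' x'" if "adm v" "adm v'" "\<And>z. v z \<le> v' z" for v v' x'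
    proof -
      have "ennreal (T v x') \<le> ennreal (T v' x')"
        unfolding T_eq[OF that(1)] T_eq[OF that(2)] using that p(2)
        by (intro add_left_mono mult_left_mono double_pot_mono) (auto simp: adm_def)
      then show ?thesis by (simp add: T_def ennreal_le_iff)
    qed
    have vs_mono: "vs n z \<le> vs (Suc n) z" for n z
    proof (induction n arbitrary: z)
      case 0 show ?case by (simp add: vs_def T_def)
    next
      case (Suc n) show ?case unfolding vs_Suc[of "Suc n"] vs_Suc[of n]
        using Suc adm0 by (intro T_mono) (auto simp: vs_Suc[symmetric])
    qed
    define v where "v z = (SUP n. vs n z)" for z
    have v_lim: "(\<lambda>n. vs n z) \<longlonglongrightarrow> v z" for z unfolding v_def
    proof (rule LIMSEQ_incseq_SUP)
      show "bdd_above (range (\<lambda>n. vs n z))" using adm0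
        by (intro bdd_aboveI2[where M="A * (1 + norm z) powr (1 - k)"]) (auto simp: adm_def)
      show "incseq (\<lambda>n. vs n z)" by (rule incseq_SucI) (rule vs_mono)
    qed
    have vs_meas[measurable]: "vs n \<in> borel_measurable borel" for n using adm0 by (simp add: adm_def)
    have v_meas[measurable]: "v \<in> borel_measurable borel"
      by (rule borel_measurable_LIMSEQ_metric[OF vs_meas v_lim])
    have v_adm: "adm v" unfolding adm_def
    proof (intro conjI allI)
      fix z
      show "0 \<le> v z" using adm0 by (intro LIMSEQ_le_const[OF v_lim]) (auto simp: adm_def)
      show "v z \<le> A * (1 + norm z) powr (1 - k)" using adm0
        by (intro LIMSEQ_le_const2[OF v_lim]) (auto simp: adm_def)
    qed (rule v_meas)
    \<comment> \<open>The formula extends the boundary function \<open>v\<close> to the whole space,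
      so the representation holds at every point once the trace of \<open>u\<close> is known to be
      \<open>v\<close>. That is the fixed point equation for \<open>v\<close>, obtained from
      \<open>double_pot_LIMSEQ\<close>.\<close>
    define F where "F x = G x + ennreal L * double_pot p k v x" for x
    define u where "u x = enn2real (F x)" for x
    have F_fin: "F x < \<infinity>" for x
      unfolding F_def using G_fin[of x] pot_finite[OF v_adm, of x] by (simp add: ennreal_mult_less_top)
    have uF: "ennreal (u x) = F x" for x unfolding u_def using F_fin[of x] by (intro ennreal_enn2real) simp
    have u_trace: "u (z, 0) = v z" for z
    proof -
      have "(\<lambda>n. double_pot p k (vs n) (z, 0)) \<longlonglongrightarrow> double_pot p k v (z, 0)"
        using vs_mono adm0 p(2) v_lim vs_meas by (intro double_pot_LIMSEQ) (auto simp: adm_def)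
      then have "(\<lambda>n. ennreal L * double_pot p k (vs n) (z, 0)) \<longlonglongrightarrow> ennreal L * double_pot p k v (z, 0)"
        by (intro ennreal_tendsto_cmult) simp_all
      then have "(\<lambda>n. G (z, 0) + ennreal L * double_pot p k (vs n) (z, 0)) \<longlonglongrightarrow> F (z, 0)"
        unfolding F_def by (intro tendsto_add tendsto_const)
      then have "(\<lambda>n. ennreal (vs (Suc n) z)) \<longlonglongrightarrow> F (z, 0)"
        unfolding vs_Suc T_eq[OF adm0] .
      moreover have "(\<lambda>n. ennreal (vs (Suc n) z)) \<longlonglongrightarrow> ennreal (v z)"
        by (intro tendsto_ennrealI LIMSEQ_Suc v_lim)
      ultimately have "ennreal (u (z, 0)) = ennreal (v z)" unfolding uF by (rule LIMSEQ_unique)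
      moreover have "0 \<le> u (z, 0)" "0 \<le> v z" using v_adm by (auto simp: u_def adm_def)
      ultimately show ?thesis by simp
    qed
    from riesz_pot_bound[OF k p] obtain R where R0: "R > 0"
      "\<forall>A>0. \<forall>v::'a \<Rightarrow> real. (\<forall>z. 0 \<le> v z \<and> v z \<le> A * (1 + norm z) powr (1 - k)) \<longrightarrow>
         (\<forall>y. riesz_pot p k v y \<le> ennreal (R * A powr p * (1 + norm y) powr - k))"
      by (elim exE conjE)
    have R: "riesz_pot p k v y \<le> ennreal (R * A powr p * (1 + norm y) powr - k)" for y
      by (rule R0(2)[rule_format, OF A]) (use v_adm in \<open>auto simp: adm_def\<close>)
    have RA: "0 \<le> R * A powr p" using R0(1) by simp
    from double_pot_hoelder[OF N3 k v_meas RA R] obtain M where M0: "M \<ge> 0"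
      "\<forall>x x'. double_pot p k v x \<le> double_pot p k v x' + ennreal (M * dist x x' powr (1/2))"
      by (elim exE conjE)
    note M = M0(1) M0(2)[rule_format]
    define w where "w x = L * enn2real (double_pot p k v x)" for x
    have dbl: "ennreal (enn2real (double_pot p k v x)) = double_pot p k v x" for x
      using pot_finite[OF v_adm, of x] by (intro ennreal_enn2real) simp
    have u_w: "u x = enn2real (G x) + w x" for x
      unfolding u_def F_def w_def using G_fin[of x] pot_finite[OF v_adm, of x] L
      by (subst enn2real_plus) (auto simp: enn2real_mult ennreal_mult_less_top)
    have w_diff: "w x - w x' \<le> L * M * dist x x' powr (1/2)" for x x'
    proof -
      have "ennreal (enn2real (double_pot p k v x)) \<le> ennreal (enn2real (double_pot p k v x') + M * dist x x' powr (1/2))"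
        using M by (simp add: dbl ennreal_plus)
      then have "enn2real (double_pot p k v x) \<le> enn2real (double_pot p k v x') + M * dist x x' powr (1/2)"
        using M(1) by (subst (asm) ennreal_le_iff) auto
      then have "w x \<le> L * (enn2real (double_pot p k v x') + M * dist x x' powr (1/2))"
        unfolding w_def using L by (intro mult_left_mono) auto
      then show ?thesis by (simp add: w_def algebra_simps)
    qed
    have w_hoelder: "\<bar>w x - w x'\<bar> \<le> L * M * dist x x' powr (1/2)" for x x'
      using w_diff[of x x'] w_diff[of x' x] by (simp add: dist_commute abs_le_iff)
    have w_bound: "\<bar>w x\<bar> \<le> L * (B * A powr p)" for x
    proof -
      have "(1 + norm (fst x)) powr (1 - k) \<le> (1 + norm (fst x)) powr 0"
        by (rule powr_mono) (use k in auto)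
      also have "\<dots> = 1" by (simp add: add_nonneg_eq_0_iff)
      finally have "B * A powr p * (1 + norm (fst x)) powr (1 - k) \<le> B * A powr p * 1"
        using B(1) by (intro mult_left_mono) auto
      then have "ennreal (B * A powr p * (1 + norm (fst x)) powr (1 - k)) \<le> ennreal (B * A powr p)"
        by (intro ennreal_leI) simp
      with adm_pot[OF v_adm, of x] have "double_pot p k v x \<le> ennreal (B * A powr p)"
        by (rule order_trans)
      then have "enn2real (double_pot p k v x) \<le> B * A powr p"
        using B(1) by (intro enn2real_leI) auto
      then show ?thesis using L by (auto simp: w_def abs_mult intro!: mult_left_mono)
    qed
    have cont_w: "isCont w x" for x
    proof -
      have "((\<lambda>x'. L * M * dist x' x powr (1/2)) \<longlongrightarrow> L * M * dist x x powr (1/2)) (at x)"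
        by (intro tendsto_intros tendsto_powr') auto
      then have "((\<lambda>x'. L * M * dist x' x powr (1/2)) \<longlongrightarrow> 0) (at x)" by simp
      then have "((\<lambda>x'. w x' - w x) \<longlongrightarrow> 0) (at x)"
        by (rule Lim_null_comparison[rotated]) (simp add: w_hoelder)
      then show ?thesis unfolding isCont_def by (rule LIM_zero_cancel)
    qed
    have "pos_sol \<mu> lam p k u"
    proof -
      have [measurable]: "u \<in> borel_measurable borel" unfolding u_def[abs_def] F_def[abs_def] by measurable
      have "u \<in> borel_measurable lborel" by simp
      then have meas: "u \<in> borel_measurable lebesgue" by (rule measurable_completion)
      have pos: "u x > 0" for x
      proof -
        have "F x > 0" using G_pos[of x] unfolding F_def by (simp add: add_pos_nonneg)
        then show ?thesis using F_fin[of x] by (simp add: u_def enn2real_positive_iff)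
      qed
      have lim: "(u \<longlongrightarrow> u (x', 0)) (at (x', 0) within upper_half)" for x'
      proof -
        \<comment> \<open>The Green part need not be continuous inside the half space; its
          continuity at boundary points, with that of \<open>w\<close>, gives the boundary limit of
          \<open>u\<close>.\<close>
        have "(G \<longlongrightarrow> ennreal (enn2real (G (x', 0)))) (at (x', 0))"
          using cont_G[of x'] G_fin[of "(x', 0)"] by (simp add: isCont_def)
        then have "((\<lambda>x. enn2real (G x)) \<longlongrightarrow> enn2real (G (x', 0))) (at (x', 0))"
          by (rule tendsto_enn2real) simp
        then have "(u \<longlongrightarrow> u (x', 0)) (at (x', 0))"
          unfolding u_w[abs_def] using cont_w[of "(x', 0)"] unfolding isCont_def by (intro tendsto_add)
        then show ?thesis by (rule tendsto_within_subset) simp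
      qed
      have H: "H_u u p k y = riesz_pot p k v y" for y
        by (simp add: H_u_def riesz_pot_def u_trace nn_integral_completion)
      have H_fin: "H_u u p k y < \<infinity>" for y
        unfolding H using R[of y] by (rule le_less_trans) simp
      have "(\<integral>\<^sup>+ y'. H_u u p k y' * ennreal (1 / norm (x - (y', 0)) powr (real DIM('a) - 1)) \<partial>lborel) = double_pot p k v x" for x :: "'a \<times> real"
        unfolding H double_pot_eq[OF v_meas] powr_minus_divide by (simp add: mult.commute)
      then have Hpot: "(\<integral>\<^sup>+ y'. H_u u p k y' * ennreal (1 / norm (x - (y', 0)) powr (real DIM('a) - 1)) \<partial>lborel) < \<infinity>" for x :: "'a \<times> real"
        using pot_finite[OF v_adm, of x] by simp
      have LK: "2 * lam / ((real DIM('a) - 1) * sigmaN TYPE('a \<times> real)) = L" by (simp add: L_def \<kappa>_def)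
      have rep: "ennreal (u x) = G x + ennreal L * double_pot p k v x" for x
        unfolding uF F_def ..
      show ?thesis
        unfolding pos_sol_def using meas pos lim H_fin Hpot rep
        by (simp add: nn_integral_completion LK u_trace G_def double_pot_def)
    qed
    moreover have "hoelder_on (1/2) closed_upper_half (\<lambda>x. u x - enn2real (G x))"
    proof -
      have "u x - enn2real (G x) = w x" for x by (simp add: u_w)
      then show ?thesis unfolding hoelder_on_def using w_hoelder w_bound by metis
    qed
    ultimately show ?thesis by blast
  qed
  moreover have "lam_s > 0" using \<kappa> B(1) A by (simp add: lam_s_def)
  ultimately show ?thesis unfolding G_def by blast
qed

theorem theorem1p1:
  fixes \<mu> :: "('a::euclidean_space \<times> real) measure" and k p :: real
  assumes N3: "DIM('a) \<ge> 2"
    and k_pos: "0 < k" and k_lt: "k < real DIM('a)"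
    and p_pos: "0 < p"
    and radon: "radon_measure \<mu>"
    and nonzero: "emeasure \<mu> (space \<mu>) \<noteq> 0"
    and supp: "measure_support \<mu> \<subseteq> upper_half"
    and pot_fin: "\<forall>x. newton_pot \<mu> x < \<infinity>"
  shows
    "(((k \<le> 1) \<or> (1 < k \<and> p < real DIM('a) / (k - 1))) \<longrightarrow>
        (\<forall>lam>0. \<not> (\<exists>u. pos_sol \<mu> lam p k u)))
     \<and> ((1 < k \<and> p = real DIM('a) / (k - 1)) \<longrightarrow>
        (\<forall>lam>0. \<not> (\<exists>u. pos_sol \<mu> lam p k u \<and> trace_in_Lp u p)))
     \<and> ((1 < k \<and> p > real DIM('a) / (k - 1) \<and>
         (\<exists>C>0. AE x in lebesgue. newton_pot \<mu> x \<le> ennreal (C * (1 + norm x) powr (1 - k)))) \<longrightarrow>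
        (\<exists>lam_s>0. \<forall>lam. 0 < lam \<and> lam < lam_s \<longrightarrow>
           (\<exists>u. pos_sol \<mu> lam p k u \<and>
              (\<exists>\<gamma>. 0 < \<gamma> \<and> \<gamma> < 1 \<and>
                 hoelder_on \<gamma> closed_upper_half
                   (\<lambda>x. u x - enn2real (\<integral>\<^sup>+ y. greenN x y \<partial>\<mu>))))))"
proof (intro conjI impI allI)
  fix lam :: real
  assume "k \<le> 1 \<or> 1 < k \<and> p < real DIM('a) / (k - 1)" and lam: "0 < lam"
  then have sub: "k \<le> 1 \<or> 1 < k \<and> p * (k - 1) < real DIM('a)" by (auto simp: field_simps)
  show "\<not> (\<exists>u. pos_sol \<mu> lam p k u)"
  proof
    assume "\<exists>u. pos_sol \<mu> lam p k u"
    then obtain u where u: "pos_sol \<mu> lam p k u" ..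
    note rate = trace_rate_green[OF N3 k_pos k_lt p_pos lam u radon nonzero]
    show False
      using sub trace_rate_imp_k_gt_1[OF N3 k_pos k_lt p_pos lam u rate]
        exponent_ge_critical[OF N3 k_pos k_lt p_pos lam u rate] by linarith
  qed
next
  fix lam :: real
  assume "1 < k \<and> p = real DIM('a) / (k - 1)" and lam: "0 < lam"
  then have crit: "p * (k - 1) = real DIM('a)" by (auto simp: field_simps)
  show "\<not> (\<exists>u. pos_sol \<mu> lam p k u \<and> trace_in_Lp u p)"
  proof
    assume "\<exists>u. pos_sol \<mu> lam p k u \<and> trace_in_Lp u p"
    then obtain u where u: "pos_sol \<mu> lam p k u" and Lp: "trace_in_Lp u p" by blast
    note rate = trace_rate_green[OF N3 k_pos k_lt p_pos lam u radon nonzero]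
    show False
      using trace_not_in_Lp_critical[OF N3 k_pos k_lt p_pos lam u rate crit] Lp by contradiction
  qed
next
  assume A: "1 < k \<and> p > real DIM('a) / (k - 1) \<and>
         (\<exists>C>0. AE x in lebesgue. newton_pot \<mu> x \<le> ennreal (C * (1 + norm x) powr (1 - k)))"
  then have k: "1 < k" and p: "real DIM('a) < p * (k - 1)" by (auto simp: field_simps)
  from A obtain C where C: "C > 0" "AE x in lebesgue. newton_pot \<mu> x \<le> ennreal (C * (1 + norm x) powr (1 - k))"
    by blast
  have half: "(0::real) < 1/2" "1/2 < (1::real)" by simp_all
  from positive_solution_exists[OF N3 k k_lt p p_pos radon nonzero supp pot_fin C]
  show "\<exists>lam_s>0. \<forall>lam. 0 < lam \<and> lam < lam_s \<longrightarrow>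
           (\<exists>u. pos_sol \<mu> lam p k u \<and>
              (\<exists>\<gamma>. 0 < \<gamma> \<and> \<gamma> < 1 \<and>
                 hoelder_on \<gamma> closed_upper_half
                   (\<lambda>x. u x - enn2real (\<integral>\<^sup>+ y. greenN x y \<partial>\<mu>))))"
    using half by metis
qed

end
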